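(* Let $N\geq 2$, $1<p<N$, and let $\Omega\subset\mathbb{R}^N$ be a bounded and smooth domain. Let $p^\star:=\frac{Np}{N-p}$ and, for $1\leq q\leq p^\star$, let $$\lambda_q:=\inf\left\{\frac{\|\nabla u\|_{p}^p}{\|u\|_{q}^p}: u\in W_0^{1,p}(\Omega)\setminus\{0\}\right\}.$$ Then for each $q\in(1,p^\star]$ it holds that $\lim\limits_{s\to q^-}\lambda_s=\lambda_q$.
   Context: $\|\cdot\|_s:=\left(\int_\Omega|\cdot|^s\,dx\right)^{1/s}$ denotes the usual norm of $L^s(\Omega)$, and $W_0^{1,p}(\Omega)$ is the usual Sobolev space (closure of $C_c^\infty(\Omega)$ in $W^{1,p}(\Omega)$). *)

theory Defs
  imports "HOL-Analysis.Analysis"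
begin

definition partial_deriv :: "'a::euclidean_space \<Rightarrow> ('a \<Rightarrow> real) \<Rightarrow> 'a \<Rightarrow> real" where
  "partial_deriv i f = (\<lambda>x. frechet_derivative f (at x) i)"

primrec continuously_differentiable :: "nat \<Rightarrow> ('a::euclidean_space \<Rightarrow> real) \<Rightarrow> bool" where
  "continuously_differentiable 0 f \<longleftrightarrow> continuous_on UNIV f"
| "continuously_differentiable (Suc k) f \<longleftrightarrow>
     (\<forall>x. f differentiable (at x)) \<and>
     (\<forall>i\<in>Basis. continuously_differentiable k (partial_deriv i f))"

definition smooth :: "('a::euclidean_space \<Rightarrow> real) \<Rightarrow> bool" where
  "smooth f \<longleftrightarrow> (\<forall>k. continuously_differentiable k f)"

text \<open>
  The boundary is smooth if near each of its points the set is, in suitable Cartesian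
  coordinates, the strict epigraph of a smooth function of \<open>N - 1\<close> variables. The unit
  vector \<open>\<nu>\<close> is the direction of the last coordinate, and \<open>x - (x \<bullet> \<nu>) *\<^sub>R \<nu>\<close> stands for the
  remaining coordinates; \<open>\<gamma>\<close> is only evaluated on the hyperplane orthogonal to \<open>\<nu>\<close>.
\<close>

definition smooth_boundary :: "'a::euclidean_space set \<Rightarrow> bool" where
  "smooth_boundary \<Omega> \<longleftrightarrow>
     (\<forall>x0\<in>frontier \<Omega>. \<exists>r>0. \<exists>\<nu> \<gamma>. norm \<nu> = 1 \<and> smooth \<gamma> \<and>
        \<Omega> \<inter> ball x0 r = {x \<in> ball x0 r. x \<bullet> \<nu> > \<gamma> (x - (x \<bullet> \<nu>) *\<^sub>R \<nu>)})"

definition bounded_smooth_domain :: "'a::euclidean_space set \<Rightarrow> bool" where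
  "bounded_smooth_domain \<Omega> \<longleftrightarrow>
     \<Omega> \<noteq> {} \<and> open \<Omega> \<and> connected \<Omega> \<and> bounded \<Omega> \<and> smooth_boundary \<Omega>"

definition test_function :: "'a::euclidean_space set \<Rightarrow> ('a \<Rightarrow> real) \<Rightarrow> bool" where
  "test_function \<Omega> \<phi> \<longleftrightarrow>
     smooth \<phi> \<and> compact (closure {x. \<phi> x \<noteq> 0}) \<and> closure {x. \<phi> x \<noteq> 0} \<subseteq> \<Omega>"

text \<open>
  Elements of Lebesgue and Sobolev spaces are represented by functions on the whole space,
  of which only the restriction to \<open>\<Omega>\<close> up to null sets matters.
\<close>

definition Lp_space :: "'a::euclidean_space set \<Rightarrow> real \<Rightarrow> ('a \<Rightarrow> 'b::euclidean_space) set" where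
  "Lp_space \<Omega> s = {f. f \<in> borel_measurable (lebesgue_on \<Omega>) \<and>
                      integrable (lebesgue_on \<Omega>) (\<lambda>x. norm (f x) powr s)}"

definition Lp_norm :: "'a::euclidean_space set \<Rightarrow> real \<Rightarrow> ('a \<Rightarrow> 'b::euclidean_space) \<Rightarrow> real" where
  "Lp_norm \<Omega> s f = (\<integral>x. norm (f x) powr s \<partial>lebesgue_on \<Omega>) powr (1 / s)"

definition locally_integrable ::
  "'a::euclidean_space set \<Rightarrow> ('a \<Rightarrow> 'b::euclidean_space) \<Rightarrow> bool" where
  "locally_integrable \<Omega> f \<longleftrightarrow> (\<forall>K. compact K \<and> K \<subseteq> \<Omega> \<longrightarrow> integrable (lebesgue_on K) f)"

definition has_weak_gradient ::
  "'a::euclidean_space set \<Rightarrow> ('a \<Rightarrow> real) \<Rightarrow> ('a \<Rightarrow> 'a) \<Rightarrow> bool" where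
  "has_weak_gradient \<Omega> u g \<longleftrightarrow>
     locally_integrable \<Omega> u \<and> locally_integrable \<Omega> g \<and>
     (\<forall>\<phi>. test_function \<Omega> \<phi> \<longrightarrow> (\<forall>i\<in>Basis.
        (\<integral>x. u x * partial_deriv i \<phi> x \<partial>lebesgue_on \<Omega>) =
        - (\<integral>x. (g x \<bullet> i) * \<phi> x \<partial>lebesgue_on \<Omega>)))"

text \<open>
  For open \<open>\<Omega>\<close> a weak gradient is unique almost everywhere on \<open>\<Omega>\<close>, so the choice below
  affects neither membership in \<open>L\<^sup>p\<close> nor the norm.
\<close>

definition weak_gradient :: "'a::euclidean_space set \<Rightarrow> ('a \<Rightarrow> real) \<Rightarrow> 'a \<Rightarrow> 'a" where
  "weak_gradient \<Omega> u = (SOME g. has_weak_gradient \<Omega> u g)"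

definition Sobolev_space :: "'a::euclidean_space set \<Rightarrow> real \<Rightarrow> ('a \<Rightarrow> real) set" where
  "Sobolev_space \<Omega> p =
     {u \<in> Lp_space \<Omega> p. \<exists>g \<in> Lp_space \<Omega> p. has_weak_gradient \<Omega> u g}"

definition Sobolev_norm :: "'a::euclidean_space set \<Rightarrow> real \<Rightarrow> ('a \<Rightarrow> real) \<Rightarrow> real" where
  "Sobolev_norm \<Omega> p u =
     (Lp_norm \<Omega> p u powr p + Lp_norm \<Omega> p (weak_gradient \<Omega> u) powr p) powr (1 / p)"

definition Sobolev_space_0 :: "'a::euclidean_space set \<Rightarrow> real \<Rightarrow> ('a \<Rightarrow> real) set" where
  "Sobolev_space_0 \<Omega> p =
     {u \<in> Sobolev_space \<Omega> p.
        \<forall>\<epsilon>>0. \<exists>\<phi>. test_function \<Omega> \<phi> \<and> Sobolev_norm \<Omega> p (\<lambda>x. u x - \<phi> x) < \<epsilon>}"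

definition critical_exponent :: "real \<Rightarrow> real \<Rightarrow> real" where
  "critical_exponent N p = N * p / (N - p)"

text \<open>
  The integrals below are finite for \<open>1 \<le> q \<le> critical_exponent N p\<close>, by the Sobolev
  embedding. The excluded zero element is the class of functions vanishing almost
  everywhere on \<open>\<Omega>\<close>.
\<close>

definition Sobolev_quotient_inf :: "'a::euclidean_space set \<Rightarrow> real \<Rightarrow> real \<Rightarrow> real" where
  "Sobolev_quotient_inf \<Omega> p q =
     Inf {Lp_norm \<Omega> p (weak_gradient \<Omega> u) powr p / Lp_norm \<Omega> q u powr p | u.
            u \<in> Sobolev_space_0 \<Omega> p \<and> \<not> (AE x in lebesgue_on \<Omega>. u x = 0)}"

end

theory Submission
  imports Defs
begin

text \<open>
  Write \<open>R s u\<close> for the quotient whose infimum over the nonzero \<open>u\<close> in \<open>W\<^sub>0\<^sup>1\<^sup>,\<^sup>p(\<Omega>)\<close> is the constant of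
  exponent \<open>s\<close>. For fixed \<open>u\<close> the norm of \<open>u\<close> in \<open>L\<^sup>s\<close> is left continuous in \<open>s\<close> by dominated convergence
  (\<open>Lp_norm_tendsto_at_left\<close>). So a function whose quotient for \<open>q\<close> is close to the infimum shows that
  the upper limit of the constants is at most the constant for \<open>q\<close>. In the other direction, Hoelder's
  inequality on the bounded set \<open>\<Omega>\<close> (\<open>Lp_norm_mono\<close>) gives \<open>R s u \<ge> c s * R q u\<close> with a factor \<open>c s\<close> that
  does not depend on \<open>u\<close> and tends to \<open>1\<close>, so the lower limit is at least the constant for \<open>q\<close>.

  Both arguments use that every \<open>u\<close> in \<open>W\<^sub>0\<^sup>1\<^sup>,\<^sup>p(\<Omega>)\<close> lies in \<open>L\<^sup>q(\<Omega>)\<close> up to the critical exponent. This is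
  essential: the integral of a function that is not integrable is \<open>0\<close> by convention, so a single \<open>u\<close>
  outside \<open>L\<^sup>q\<close> would make the constant for \<open>q\<close> vanish. Most of the work is therefore the Sobolev
  embedding (\<open>Sobolev_embedding\<close>).

  The embedding rests on the Gagliardo-Nirenberg-Sobolev inequality for continuously differentiable
  functions of bounded support (\<open>Sobolev_inequality\<close>). By the fundamental theorem of calculus, such a
  function is bounded at each point by the integrals of the norm of its gradient along the \<open>N\<close>
  coordinate lines through the point, and an inequality of Loomis-Whitney type
  (\<open>nn_integral_grid_lines\<close>), proved by induction on the number of coordinates with Hoelder's
  inequality, bounds the integral of a product of powers of such line integrals. Applying this to a
  power of the function gives all exponents \<open>p > 1\<close>.

  To pass from test functions to \<open>W\<^sub>0\<^sup>1\<^sup>,\<^sup>p(\<Omega>)\<close> by density and Fatou's lemma, one has to know that the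
  Sobolev norm of \<open>u - \<phi>\<close> controls the gradient of \<open>\<phi>\<close>. As this norm is defined with a chosen weak
  gradient, uniqueness of weak gradients is needed (\<open>weak_gradient_unique\<close>). It follows from the
  fundamental lemma of the calculus of variations, which is derived from Lebesgue differentiation and
  smooth bump functions that approximate the indicators of boxes.
\<close>

section \<open>Powers and Hoelder's inequality for extended nonnegative reals\<close>

text \<open>
  Powers of extended nonnegative reals. The value at exponent \<open>0\<close> is \<open>1\<close> also for the bases \<open>0\<close> and
  \<open>\<infinity>\<close> (unlike \<^const>\<open>powr\<close>, for which \<open>0 powr 0 = 0\<close>), so that factors with weight \<open>0\<close> drop out of
  Hoelder's inequality; this happens at the last stage of the grid-line estimate.
\<close>

definition epow :: "ennreal \<Rightarrow> real \<Rightarrow> ennreal" where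
  "epow x a = (if a = 0 then 1 else if x = top then top else ennreal (enn2real x powr a))"

lemma epow_0 [simp]: "epow x 0 = 1"
  by (simp add: epow_def)

lemma epow_one [simp]: "epow 1 a = 1"
  by (simp add: epow_def)

lemma epow_1 [simp]: "epow x 1 = x"
  by (cases x) (auto simp: epow_def)

lemma epow_ennreal: "0 \<le> x \<Longrightarrow> a \<noteq> 0 \<Longrightarrow> epow (ennreal x) a = ennreal (x powr a)"
  by (simp add: epow_def)

lemma epow_top: "a \<noteq> 0 \<Longrightarrow> epow top a = top"
  by (simp add: epow_def)

lemma epow_zero: "a \<noteq> 0 \<Longrightarrow> epow 0 a = 0"
  by (simp add: epow_def)

lemma epow_measurable [measurable]:
  assumes [measurable]: "f \<in> borel_measurable M"
  shows "(\<lambda>x. epow (f x) a) \<in> borel_measurable M"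
  unfolding epow_def by measurable

lemma epow_mono: "x \<le> y \<Longrightarrow> 0 \<le> a \<Longrightarrow> epow x a \<le> epow y a"
  by (cases x; cases y) (auto simp: epow_def top_unique intro!: ennreal_leI powr_mono2)

lemma epow_add: "0 \<le> a \<Longrightarrow> 0 \<le> b \<Longrightarrow> epow x (a + b) = epow x a * epow x b"
  by (cases x) (auto simp: epow_def powr_add ennreal_mult ennreal_top_mult)

lemma epow_mult:
  assumes "0 \<le> a" shows "epow (x * y) a = epow x a * epow y a"
proof (cases "a = 0")
  case False
  then have a: "a > 0" using assms by simp
  show ?thesis
  proof (cases "x = 0 \<or> y = 0")
    case True then show ?thesis using a by (auto simp: epow_zero)
  next
    case nz: False
    show ?thesis
    proof (cases "x = top \<or> y = top")
      case True
      then have "x * y = top" "epow x a * epow y a = top"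
        using nz a by (auto simp: epow_def ennreal_mult_eq_top_iff enn2real_positive_iff less_top
            ennreal_eq_0_iff zero_less_iff_neq_zero top.not_eq_extremum enn2real_eq_0_iff split: if_splits)
      then show ?thesis using a by (simp add: epow_top)
    next
      case False
      then obtain r s where "x = ennreal r" "y = ennreal s" "0 \<le> r" "0 \<le> s"
        by (metis ennreal_cases)
      then show ?thesis using a
        by (simp add: epow_ennreal powr_mult flip: ennreal_mult)
    qed
  qed
qed simp

lemma epow_eq_0_iff: "a > 0 \<Longrightarrow> epow x a = 0 \<longleftrightarrow> x = 0"
  by (cases x) (auto simp: epow_def ennreal_eq_0_iff)

lemma epow_power: "0 \<le> a \<Longrightarrow> epow x a ^ n = epow x (real n * a)"
proof (induction n)
  case (Suc n)
  have "real (Suc n) * a = a + real n * a" by (simp add: algebra_simps)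
  then show ?case using Suc by (simp only: power_Suc epow_add mult_nonneg_nonneg of_nat_0_le_iff)
qed simp

text \<open>
  The weighted inequality between geometric and arithmetic means is concavity of the logarithm.
\<close>

lemma weighted_geometric_le_arithmetic:
  fixes x a :: "'i \<Rightarrow> real"
  assumes "finite I" "\<And>i. i \<in> I \<Longrightarrow> 0 \<le> x i" "\<And>i. i \<in> I \<Longrightarrow> 0 < a i" "(\<Sum>i\<in>I. a i) = 1"
  shows "(\<Prod>i\<in>I. x i powr a i) \<le> (\<Sum>i\<in>I. a i * x i)"
proof (cases "\<exists>i\<in>I. x i = 0")
  case True
  then have "(\<Prod>i\<in>I. x i powr a i) = 0"
    using assms(1) by auto
  also have "\<dots> \<le> (\<Sum>i\<in>I. a i * x i)"
    using assms by (intro sum_nonneg) (simp add: less_imp_le)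
  finally show ?thesis .
next
  case False
  then have pos: "x i > 0" if "i \<in> I" for i
    using assms(2)[OF that] that by force
  have "I \<noteq> {}" using assms(4) by auto
  have "(\<Sum>i\<in>I. a i * ln (x i)) \<le> ln (\<Sum>i\<in>I. a i *\<^sub>R x i)"
    using ln_concave \<open>I \<noteq> {}\<close> assms pos
    by (intro concave_on_sum[of I "{0<..}"]) (auto simp: less_imp_le)
  moreover have "(\<Sum>i\<in>I. a i *\<^sub>R x i) > 0"
    using \<open>I \<noteq> {}\<close> assms pos by (intro sum_pos) auto
  ultimately have "exp (\<Sum>i\<in>I. a i * ln (x i)) \<le> (\<Sum>i\<in>I. a i * x i)"
    by (simp add: ln_ge_iff)
  moreover have "exp (\<Sum>i\<in>I. a i * ln (x i)) = (\<Prod>i\<in>I. x i powr a i)"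
    unfolding exp_sum[OF assms(1)] using pos
    by (intro prod.cong) (auto simp: powr_def less_imp_neq[symmetric])
  ultimately show ?thesis by simp
qed

lemma weighted_geometric_le_arithmetic_ennreal:
  fixes x :: "'i \<Rightarrow> ennreal" and a :: "'i \<Rightarrow> real"
  assumes I: "finite I" and a: "\<And>i. i \<in> I \<Longrightarrow> 0 < a i" "(\<Sum>i\<in>I. a i) = 1"
  shows "(\<Prod>i\<in>I. epow (x i) (a i)) \<le> (\<Sum>i\<in>I. a i * x i)"
proof (cases "\<exists>i\<in>I. x i = top")
  case True
  then obtain i where "i \<in> I" "x i = top" by auto
  then have "(\<Sum>i\<in>I. ennreal (a i) * x i) = top"
    using I a(1)[of i] by (auto simp: ennreal_mult_eq_top_iff intro!: bexI[of _ i])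
  then show ?thesis by simp
next
  case False
  define r where "r i = enn2real (x i)" for i
  have x: "x i = ennreal (r i)" "0 \<le> r i" if "i \<in> I" for i
    using False that by (auto simp: r_def less_top)
  have "(\<Prod>i\<in>I. epow (x i) (a i)) = (\<Prod>i\<in>I. ennreal (r i powr a i))"
    using a(1) x by (intro prod.cong) (auto simp: epow_ennreal less_imp_neq[symmetric])
  also have "\<dots> = ennreal (\<Prod>i\<in>I. r i powr a i)"
    by (intro prod_ennreal) auto
  also have "\<dots> \<le> ennreal (\<Sum>i\<in>I. a i * r i)"
    using I a x by (intro ennreal_leI weighted_geometric_le_arithmetic) auto
  also have "\<dots> = (\<Sum>i\<in>I. ennreal (a i) * x i)"
    using a(1) x by (subst sum_ennreal[symmetric]) (auto simp: ennreal_mult less_imp_le intro!: sum.cong)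
  finally show ?thesis .
qed

text \<open>
  After division of each \<open>f i\<close> by its integral, the weighted mean inequality bounds the product of the
  powers by a convex combination of functions of integral \<open>1\<close>. This normalisation is possible unless
  some integral is \<open>0\<close> (then the product vanishes almost everywhere) or some integral is \<open>\<infinity>\<close> while
  none is \<open>0\<close> (then the right-hand side is \<open>\<infinity>\<close>).
\<close>

lemma nn_integral_Holder_positive:
  fixes f :: "'i \<Rightarrow> 'b \<Rightarrow> ennreal"
  assumes I: "finite I" and a: "\<And>i. i \<in> I \<Longrightarrow> 0 < a i" "(\<Sum>i\<in>I. a i) = 1"
    and [measurable]: "\<And>i. i \<in> I \<Longrightarrow> f i \<in> borel_measurable M"
  shows "(\<integral>\<^sup>+x. (\<Prod>i\<in>I. epow (f i x) (a i)) \<partial>M) \<le> (\<Prod>i\<in>I. epow (\<integral>\<^sup>+x. f i x \<partial>M) (a i))"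
proof (cases "\<exists>i\<in>I. (\<integral>\<^sup>+x. f i x \<partial>M) = 0")
  case True
  then obtain i where i: "i \<in> I" "(\<integral>\<^sup>+x. f i x \<partial>M) = 0" by auto
  then have "AE x in M. f i x = 0"
    by (simp add: nn_integral_0_iff_AE)
  then have "AE x in M. (\<Prod>i\<in>I. epow (f i x) (a i)) = 0"
    by eventually_elim (use i a(1)[of i] I in \<open>auto simp: epow_zero less_imp_neq[symmetric] intro!: prod_zero bexI[of _ i]\<close>)
  then have "(\<integral>\<^sup>+x. (\<Prod>i\<in>I. epow (f i x) (a i)) \<partial>M) = 0"
    by (subst nn_integral_0_iff_AE) auto
  then show ?thesis by simp
next
  case nz: False
  show ?thesis
  proof (cases "\<exists>i\<in>I. (\<integral>\<^sup>+x. f i x \<partial>M) = top")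
    case True
    then obtain i where i: "i \<in> I" "(\<integral>\<^sup>+x. f i x \<partial>M) = top" by auto
    have "(\<Prod>i\<in>I. epow (\<integral>\<^sup>+x. f i x \<partial>M) (a i)) = top"
    proof -
      have "(\<Prod>j\<in>I-{i}. epow (\<integral>\<^sup>+x. f j x \<partial>M) (a j)) \<noteq> 0"
        using I nz a(1) by (auto simp: epow_eq_0_iff)
      then show ?thesis
        using i I a(1)[of i] by (simp add: prod.remove[of I i] epow_top ennreal_top_mult)
    qed
    then show ?thesis by simp
  next
    case False
    define c where "c i = enn2real (\<integral>\<^sup>+x. f i x \<partial>M)" for i
    have c: "(\<integral>\<^sup>+x. f i x \<partial>M) = ennreal (c i)" "0 < c i" if "i \<in> I" for i
      using False nz that by (auto simp: c_def less_top enn2real_positive_iff zero_less_iff_neq_zero)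
    let ?C = "\<Prod>i\<in>I. epow (ennreal (c i)) (a i)"
    let ?g = "\<lambda>i x. ennreal (1 / c i) * f i x"
    have fg: "epow (f i x) (a i) = epow (ennreal (c i)) (a i) * epow (?g i x) (a i)" if "i \<in> I" for i x
    proof -
      have "f i x = ennreal (c i) * ?g i x"
        using c(2)[OF that] by (simp add: mult.assoc[symmetric] flip: ennreal_mult)
      then show ?thesis using a(1)[OF that] epow_mult by (metis less_imp_le)
    qed
    have "(\<integral>\<^sup>+x. (\<Prod>i\<in>I. epow (f i x) (a i)) \<partial>M) = (\<integral>\<^sup>+x. ?C * (\<Prod>i\<in>I. epow (?g i x) (a i)) \<partial>M)"
      by (intro nn_integral_cong, subst prod.distrib[symmetric]) (auto intro!: prod.cong simp: fg)
    also have "\<dots> \<le> (\<integral>\<^sup>+x. ?C * (\<Sum>i\<in>I. a i * ?g i x) \<partial>M)"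
      using I a by (intro nn_integral_mono mult_left_mono weighted_geometric_le_arithmetic_ennreal) auto
    also have "\<dots> = ?C * (\<Sum>i\<in>I. a i * (ennreal (1 / c i) * (\<integral>\<^sup>+x. f i x \<partial>M)))"
      by (simp add: nn_integral_cmult nn_integral_sum)
    also have "(\<Sum>i\<in>I. a i * (ennreal (1 / c i) * (\<integral>\<^sup>+x. f i x \<partial>M))) = (\<Sum>i\<in>I. ennreal (a i))"
    proof (intro sum.cong refl)
      fix i assume i: "i \<in> I"
      have "ennreal (1 / c i) * ennreal (c i) = 1"
        using c(2)[OF i] by (simp flip: ennreal_mult)
      then show "ennreal (a i) * (ennreal (1 / c i) * (\<integral>\<^sup>+x. f i x \<partial>M)) = ennreal (a i)"
        by (simp add: c(1)[OF i])
    qed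
    also have "\<dots> = 1"
      using a by (simp add: sum_ennreal less_imp_le)
    finally show ?thesis using c by simp
  qed
qed

lemma nn_integral_Holder:
  fixes f :: "'i \<Rightarrow> 'b \<Rightarrow> ennreal"
  assumes I: "finite I" and a: "\<And>i. i \<in> I \<Longrightarrow> 0 \<le> a i" "(\<Sum>i\<in>I. a i) = 1"
    and f: "\<And>i. i \<in> I \<Longrightarrow> f i \<in> borel_measurable M"
  shows "(\<integral>\<^sup>+x. (\<Prod>i\<in>I. epow (f i x) (a i)) \<partial>M) \<le> (\<Prod>i\<in>I. epow (\<integral>\<^sup>+x. f i x \<partial>M) (a i))"
proof -
  define J where "J = {i\<in>I. a i \<noteq> 0}"
  have J: "(\<Prod>i\<in>I. epow (g i) (a i)) = (\<Prod>i\<in>J. epow (g i) (a i))" for g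
    unfolding J_def using I by (intro prod.mono_neutral_right) auto
  have "(\<Sum>i\<in>J. a i) = 1"
    using a(2) I by (subst sum.mono_neutral_right[of I J a, symmetric]) (auto simp: J_def)
  moreover have "finite J" "\<And>i. i \<in> J \<Longrightarrow> 0 < a i" "\<And>i. i \<in> J \<Longrightarrow> f i \<in> borel_measurable M"
    using I f a(1) by (auto simp: J_def order_less_le)
  ultimately show ?thesis unfolding J by (intro nn_integral_Holder_positive)
qed

lemma nn_integral_Holder_two:
  assumes "f \<in> borel_measurable M" "g \<in> borel_measurable M" "0 \<le> a" "0 \<le> b" "a + b = 1"
  shows "(\<integral>\<^sup>+x. epow (f x) a * epow (g x) b \<partial>M) \<le> epow (\<integral>\<^sup>+x. f x \<partial>M) a * epow (\<integral>\<^sup>+x. g x \<partial>M) b"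
  using nn_integral_Holder[of "UNIV :: bool set" "\<lambda>i. if i then a else b" "\<lambda>i. if i then f else g" M] assms
  by (simp add: UNIV_bool mult.commute add.commute)

section \<open>Integrals along coordinate lines\<close>

text \<open>
  An inequality of Loomis-Whitney type for the integrals of \<open>f\<close> along the lines parallel to the axes.
  For \<open>p = 1 / (card I - 1)\<close> the first factor disappears, and this is the form that is of interest; the
  power of \<open>f\<close> itself is kept because it makes the statement inductive. To add a coordinate \<open>i\<close>,
  integrate over \<open>x i\<close> first. The factor belonging to \<open>i\<close> is the power \<open>p\<close> of the marginal \<open>F\<close> and
  does not depend on \<open>x i\<close>; Hoelder's inequality applied to the others, with weights \<open>1 - k p, p, ..., p\<close>,
  replaces each of them by the corresponding expression in \<open>F\<close>, which is the left-hand side for \<open>F\<close>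
  in the remaining coordinates.
\<close>

lemma (in product_sigma_finite) nn_integral_grid_lines:
  fixes p :: real
  assumes "finite I" "I \<noteq> {}" "f \<in> borel_measurable (Pi\<^sub>M I M)" "0 \<le> p" "(card I - 1) * p \<le> 1"
  shows "(\<integral>\<^sup>+x. epow (f x) (1 - (card I - 1) * p) * (\<Prod>i\<in>I. epow (\<integral>\<^sup>+t. f (x(i := t)) \<partial>M i) p) \<partial>Pi\<^sub>M I M)
     \<le> epow (\<integral>\<^sup>+x. f x \<partial>Pi\<^sub>M I M) (1 + p)"
  using assms
proof (induction I arbitrary: f rule: finite_ne_induct)
  case (singleton i)
  note [measurable] = \<open>f \<in> borel_measurable (Pi\<^sub>M {i} M)\<close>
  have eq: "(\<integral>\<^sup>+t. f (x(i := t)) \<partial>M i) = (\<integral>\<^sup>+x. f x \<partial>Pi\<^sub>M {i} M)" if "x \<in> space (Pi\<^sub>M {i} M)" for x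
  proof -
    have "x(i := t) = (\<lambda>j\<in>{i}. t)" for t
      using that by (auto simp: space_PiM PiE_def extensional_def restrict_def)
    moreover have "(\<integral>\<^sup>+x. f x \<partial>Pi\<^sub>M {i} M) = (\<integral>\<^sup>+t. f (\<lambda>j\<in>{i}. t) \<partial>M i)"
    proof -
      have "(\<integral>\<^sup>+x. f x \<partial>Pi\<^sub>M {i} M) = (\<integral>\<^sup>+x. f (\<lambda>j\<in>{i}. x i) \<partial>Pi\<^sub>M {i} M)"
        by (intro nn_integral_cong arg_cong[where f=f]) (auto simp: space_PiM PiE_def extensional_def restrict_def)
      also have "\<dots> = (\<integral>\<^sup>+t. f (\<lambda>j\<in>{i}. t) \<partial>M i)"
        by (intro product_nn_integral_singleton measurable_compose[OF measurable_restrict singleton(1)]) auto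
      finally show ?thesis .
    qed
    ultimately show ?thesis by simp
  qed
  have "(\<integral>\<^sup>+x. epow (f x) (1 - (card {i} - 1) * p) * (\<Prod>i\<in>{i}. epow (\<integral>\<^sup>+t. f (x(i := t)) \<partial>M i) p) \<partial>Pi\<^sub>M {i} M)
    = (\<integral>\<^sup>+x. f x * epow (\<integral>\<^sup>+x. f x \<partial>Pi\<^sub>M {i} M) p \<partial>Pi\<^sub>M {i} M)"
    by (intro nn_integral_cong) (simp add: eq)
  also have "\<dots> = epow (\<integral>\<^sup>+x. f x \<partial>Pi\<^sub>M {i} M) (1 + p)"
    using \<open>0 \<le> p\<close> by (simp add: nn_integral_multc epow_add)
  finally show ?case by (rule eq_refl)
next
  case (insert i s)
  note f [measurable] = \<open>f \<in> borel_measurable (Pi\<^sub>M (insert i s) M)\<close>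
  define k where "k = card s"
  have k: "card (insert i s) - 1 = k" "k \<ge> 1" "real k * p \<le> 1" and k1: "real (k - 1) * p \<le> 1" "real (k - 1) * p = real k * p - p"
    using insert by (auto simp: k_def Suc_le_eq card_gt_0_iff of_nat_diff left_diff_distrib)
  define F where "F y = (\<integral>\<^sup>+t. f (y(i := t)) \<partial>M i)" for y
  have [measurable]: "F \<in> borel_measurable (Pi\<^sub>M s M)"
  proof -
    interpret sigma_finite_measure "M i" by (rule sigma_finite_measures)
    show ?thesis unfolding F_def
      using measurable_compose[OF measurable_add_dim f]
      by (intro borel_measurable_nn_integral) (simp add: case_prod_beta')
  qed
  let ?G = "\<lambda>y j t. \<integral>\<^sup>+r. f (y(i := t, j := r)) \<partial>M j"
  \<comment> \<open>Hoelder in the variable of index i, for fixed remaining coordinates y\<close>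
  have inner: "(\<integral>\<^sup>+t. epow (f (y(i:=t))) (1 - k * p) * (\<Prod>j\<in>insert i s. epow (?G y j t) p) \<partial>M i)
     \<le> epow (F y) (1 - (k - 1) * p) * (\<Prod>j\<in>s. epow (\<integral>\<^sup>+r. F (y(j := r)) \<partial>M j) p)"
    if y: "y \<in> space (Pi\<^sub>M s M)" for y
  proof -
    have m1: "(\<lambda>t. y(i := t)) \<in> M i \<rightarrow>\<^sub>M Pi\<^sub>M (insert i s) M"
      by (rule measurable_fun_upd[where J=s]) (use y in auto)
    note [measurable] = measurable_compose[OF m1 f]
    have m2: "(\<lambda>(t,r). f (y(i := t, j := r))) \<in> borel_measurable (M i \<Otimes>\<^sub>M M j)" if "j \<in> s" for j
    proof -
      have "(\<lambda>x. (y(i := fst x))(j := snd x)) \<in> M i \<Otimes>\<^sub>M M j \<rightarrow>\<^sub>M Pi\<^sub>M (insert i s) M"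
        by (rule measurable_fun_upd[where J="insert i s"]) (use that m1 in auto)
      from measurable_compose[OF this f] show ?thesis by (simp add: case_prod_beta')
    qed
    have G [measurable]: "?G y j \<in> borel_measurable (M i)" if "j \<in> s" for j
    proof -
      interpret sigma_finite_measure "M j" by (rule sigma_finite_measures)
      show ?thesis by (rule borel_measurable_nn_integral) (use m2[OF that] in simp)
    qed
    \<comment> \<open>By Tonelli, integrating a line integral in direction j over coordinate i
        gives a line integral of the marginal F.\<close>
    have swap: "(\<integral>\<^sup>+t. ?G y j t \<partial>M i) = (\<integral>\<^sup>+r. F (y(j := r)) \<partial>M j)" if "j \<in> s" for j
    proof -
      have "j \<noteq> i" using that \<open>i \<notin> s\<close> by auto
      interpret pair_sigma_finite "M i" "M j"
        by (intro pair_sigma_finite.intro sigma_finite_measures)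
      have "(\<integral>\<^sup>+t. ?G y j t \<partial>M i) = (\<integral>\<^sup>+r. \<integral>\<^sup>+t. f (y(i := t, j := r)) \<partial>M i \<partial>M j)"
        using Fubini'[OF m2[OF that]] by simp
      then show ?thesis using \<open>j \<noteq> i\<close> by (simp add: F_def fun_upd_twist)
    qed
    let ?h = "\<lambda>j t. if j = i then f (y(i:=t)) else ?G y j t"
    let ?a = "\<lambda>j. if j = i then 1 - k * p else p"
    have ins: "(\<Prod>j\<in>insert i s. epow (g j) (?a j)) = epow (g i) (1 - k * p) * (\<Prod>j\<in>s. epow (g j) p)" for g
    proof -
      have "(\<Prod>j\<in>s. epow (g j) (?a j)) = (\<Prod>j\<in>s. epow (g j) p)"
        by (rule prod.cong) (use \<open>i \<notin> s\<close> in auto)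
      then show ?thesis
        using \<open>finite s\<close> \<open>i \<notin> s\<close> by simp
    qed
    have "(\<integral>\<^sup>+t. epow (f (y(i:=t))) (1 - k * p) * (\<Prod>j\<in>insert i s. epow (?G y j t) p) \<partial>M i)
      = (\<integral>\<^sup>+t. epow (F y) p * (\<Prod>j\<in>insert i s. epow (?h j t) (?a j)) \<partial>M i)"
    proof (rule nn_integral_cong)
      fix t
      have "(\<Prod>j\<in>s. epow (?h j t) p) = (\<Prod>j\<in>s. epow (?G y j t) p)"
        by (rule prod.cong) (use \<open>i \<notin> s\<close> in auto)
      then show "epow (f (y(i:=t))) (1 - k * p) * (\<Prod>j\<in>insert i s. epow (?G y j t) p)
          = epow (F y) p * (\<Prod>j\<in>insert i s. epow (?h j t) (?a j))"
        unfolding ins using \<open>finite s\<close> \<open>i \<notin> s\<close> by (simp add: F_def mult_ac del: fun_upd_apply)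
    qed
    also have "\<dots> = epow (F y) p * (\<integral>\<^sup>+t. (\<Prod>j\<in>insert i s. epow (?h j t) (?a j)) \<partial>M i)"
      by (intro nn_integral_cmult borel_measurable_prod_ennreal) auto
    also have "\<dots> \<le> epow (F y) p * (\<Prod>j\<in>insert i s. epow (\<integral>\<^sup>+t. ?h j t \<partial>M i) (?a j))"
    proof (intro mult_left_mono nn_integral_Holder)
      have "(\<Sum>j\<in>s. ?a j) = k * p"
        using insert by (subst sum.cong[where h="\<lambda>_. p", OF refl]) (auto simp: k_def)
      then show "(\<Sum>j\<in>insert i s. ?a j) = 1"
        using insert by simp
    qed (use insert k in auto)
    also have "\<dots> = epow (F y) p * (epow (F y) (1 - k * p) * (\<Prod>j\<in>s. epow (\<integral>\<^sup>+r. F (y(j := r)) \<partial>M j) p))"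
    proof -
      have "(\<Prod>j\<in>s. epow (\<integral>\<^sup>+t. ?h j t \<partial>M i) p) = (\<Prod>j\<in>s. epow (\<integral>\<^sup>+r. F (y(j := r)) \<partial>M j) p)"
      proof (rule prod.cong[OF refl])
        fix j assume "j \<in> s"
        moreover then have "j \<noteq> i" using \<open>i \<notin> s\<close> by auto
        ultimately show "epow (\<integral>\<^sup>+t. ?h j t \<partial>M i) p = epow (\<integral>\<^sup>+r. F (y(j := r)) \<partial>M j) p"
          by (simp add: swap del: fun_upd_apply)
      qed
      then show ?thesis unfolding ins by (simp add: F_def[of y] del: fun_upd_apply)
    qed
    also have "\<dots> = epow (F y) (1 - (k - 1) * p) * (\<Prod>j\<in>s. epow (\<integral>\<^sup>+r. F (y(j := r)) \<partial>M j) p)"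
    proof -
      have "1 - real (k - 1) * p = p + (1 - real k * p)"
        using k1(2) by simp
      then have "epow (F y) (1 - real (k - 1) * p) = epow (F y) p * epow (F y) (1 - real k * p)"
        using k(3) \<open>0 \<le> p\<close> by (simp only: epow_add diff_ge_0_iff_ge)
      then show ?thesis by (simp only: mult.assoc)
    qed
    finally show ?thesis .
  qed
  have mG: "(\<lambda>x. \<integral>\<^sup>+r. f (x(j := r)) \<partial>M j) \<in> borel_measurable (Pi\<^sub>M (insert i s) M)" if "j \<in> insert i s" for j
  proof -
    interpret sigma_finite_measure "M j" by (rule sigma_finite_measures)
    have "(\<lambda>x. (fst x)(j := snd x)) \<in> Pi\<^sub>M (insert i s) M \<Otimes>\<^sub>M M j \<rightarrow>\<^sub>M Pi\<^sub>M (insert i s) M"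
      by (rule measurable_fun_upd[where J="insert i s"]) (use that in auto)
    from measurable_compose[OF this f] show ?thesis 
      by (intro borel_measurable_nn_integral) (simp add: case_prod_beta')
  qed
  have "(\<integral>\<^sup>+x. epow (f x) (1 - k * p) * (\<Prod>j\<in>insert i s. epow (\<integral>\<^sup>+r. f (x(j := r)) \<partial>M j) p) \<partial>Pi\<^sub>M (insert i s) M)
    = (\<integral>\<^sup>+y. \<integral>\<^sup>+t. epow (f (y(i:=t))) (1 - k * p) * (\<Prod>j\<in>insert i s. epow (?G y j t) p) \<partial>M i \<partial>Pi\<^sub>M s M)"
    using insert mG by (intro product_nn_integral_insert) auto
  also have "\<dots> \<le> (\<integral>\<^sup>+y. epow (F y) (1 - (card s - 1) * p) * (\<Prod>j\<in>s. epow (\<integral>\<^sup>+r. F (y(j := r)) \<partial>M j) p) \<partial>Pi\<^sub>M s M)"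
    using inner by (intro nn_integral_mono) (simp add: k_def)
  also have "\<dots> \<le> epow (\<integral>\<^sup>+y. F y \<partial>Pi\<^sub>M s M) (1 + p)"
    using insert k1 by (intro insert.IH) (auto simp: k_def)
  also have "(\<integral>\<^sup>+y. F y \<partial>Pi\<^sub>M s M) = (\<integral>\<^sup>+x. f x \<partial>Pi\<^sub>M (insert i s) M)"
    using insert unfolding F_def by (intro product_nn_integral_insert[symmetric]) auto
  finally show ?case by (simp only: k)
qed

text \<open>
  Lebesgue measure is the image of the product measure over the coordinates, and replacing the
  coordinate \<open>i\<close> by \<open>t\<close> corresponds to passing from \<open>x\<close> to \<open>x + (t - x \<bullet> i) *\<^sub>R i\<close>.
\<close>

lemma nn_integral_grid_lines_lborel:
  fixes f :: "'a::euclidean_space \<Rightarrow> ennreal"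
  assumes [measurable]: "f \<in> borel_measurable borel" and N: "DIM('a) \<ge> 2"
  shows "(\<integral>\<^sup>+x. (\<Prod>i\<in>Basis. epow (\<integral>\<^sup>+t. f (x + (t - x \<bullet> i) *\<^sub>R i) \<partial>lborel) (1 / (DIM('a) - 1))) \<partial>lborel)
    \<le> epow (\<integral>\<^sup>+x. f x \<partial>lborel) (DIM('a) / (DIM('a) - 1))"
proof -
  let ?T = "\<lambda>w. \<Sum>b\<in>Basis. w b *\<^sub>R (b::'a)"
  let ?P = "\<Pi>\<^sub>M b\<in>(Basis::'a set). (lborel :: real measure)"
  let ?q = "1 / real (DIM('a) - 1)"
  interpret product_sigma_finite "\<lambda>_::'a. lborel :: real measure" by standard
  have T [measurable]: "?T \<in> ?P \<rightarrow>\<^sub>M borel" by measurable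
  have line: "?T (w(i := t)) = ?T w + (t - ?T w \<bullet> i) *\<^sub>R i" if "i \<in> Basis" for w i t
  proof -
    have "?T (w(i := t)) = t *\<^sub>R i + (\<Sum>b\<in>Basis - {i}. w b *\<^sub>R b)"
      using that by (subst sum.remove[of _ i]) (auto intro!: sum.cong)
    moreover have "?T w = w i *\<^sub>R i + (\<Sum>b\<in>Basis - {i}. w b *\<^sub>R b)"
      using that by (subst sum.remove[of _ i]) auto
    moreover have "?T w \<bullet> i = w i"
      using that by simp
    ultimately show ?thesis by (simp add: algebra_simps)
  qed
  have m: "(\<lambda>x. \<integral>\<^sup>+t. f (x + (t - x \<bullet> i) *\<^sub>R i) \<partial>lborel) \<in> borel_measurable borel" for i :: 'a
    by measurable
  have fT: "(\<lambda>w. f (?T w)) \<in> borel_measurable ?P"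
    using measurable_compose[OF T assms(1)] .
  have c: "real (card (Basis::'a set) - 1) * ?q = 1"
    using N by simp
  have "(\<integral>\<^sup>+x. (\<Prod>i\<in>Basis. epow (\<integral>\<^sup>+t. f (x + (t - x \<bullet> i) *\<^sub>R i) \<partial>lborel) ?q) \<partial>lborel)
     = (\<integral>\<^sup>+w. (\<Prod>i\<in>Basis. epow (\<integral>\<^sup>+t. f (?T w + (t - ?T w \<bullet> i) *\<^sub>R i) \<partial>lborel) ?q) \<partial>?P)"
    by (subst lborel_eq, subst nn_integral_distr) (use m in auto)
  also have "\<dots> = (\<integral>\<^sup>+w. epow (f (?T w)) (1 - real (card (Basis::'a set) - 1) * ?q)
      * (\<Prod>i\<in>Basis. epow (\<integral>\<^sup>+t. f (?T (w(i := t))) \<partial>lborel) ?q) \<partial>?P)"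
    unfolding c by (simp add: line cong: prod.cong del: fun_upd_apply)
  also have "\<dots> \<le> epow (\<integral>\<^sup>+w. f (?T w) \<partial>?P) (1 + ?q)"
    using c by (intro nn_integral_grid_lines fT) auto
  also have "(\<integral>\<^sup>+w. f (?T w) \<partial>?P) = (\<integral>\<^sup>+x. f x \<partial>lborel)"
    by (subst (2) lborel_eq, subst nn_integral_distr) auto
  also have "1 + ?q = DIM('a) / real (DIM('a) - 1)"
    using N by (simp add: field_simps of_nat_diff)
  finally show ?thesis .
qed

text \<open>
  The case of exponent \<open>1\<close> of the Sobolev inequality, in a form that does not mention derivatives: \<open>v\<close>
  stands for the absolute value of a function and \<open>f\<close> for the norm of its gradient, and the
  fundamental theorem of calculus along the coordinate lines supplies the assumption. The power
  \<open>N / (N - 1)\<close> of \<open>v\<close> is distributed evenly over the \<open>N\<close> line integrals.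
\<close>

lemma Gagliardo_Nirenberg:
  fixes f v :: "'a::euclidean_space \<Rightarrow> ennreal"
  assumes f: "f \<in> borel_measurable borel" and N: "DIM('a) \<ge> 2"
    and v: "\<And>x i. i \<in> Basis \<Longrightarrow> v x \<le> (\<integral>\<^sup>+t. f (x + (t - x \<bullet> i) *\<^sub>R i) \<partial>lborel)"
  shows "(\<integral>\<^sup>+x. epow (v x) (DIM('a) / (DIM('a) - 1)) \<partial>lborel) \<le> epow (\<integral>\<^sup>+x. f x \<partial>lborel) (DIM('a) / (DIM('a) - 1))"
proof -
  let ?q = "1 / real (DIM('a) - 1)"
  have "epow (v x) (DIM('a) / real (DIM('a) - 1)) \<le> (\<Prod>i\<in>Basis. epow (\<integral>\<^sup>+t. f (x + (t - x \<bullet> i) *\<^sub>R i) \<partial>lborel) ?q)" for x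
  proof -
    have "epow (v x) (DIM('a) / real (DIM('a) - 1)) = (\<Prod>i\<in>(Basis::'a set). epow (v x) ?q)"
      by (simp add: epow_power)
    also have "\<dots> \<le> (\<Prod>i\<in>Basis. epow (\<integral>\<^sup>+t. f (x + (t - x \<bullet> i) *\<^sub>R i) \<partial>lborel) ?q)"
      by (intro prod_mono_ennreal epow_mono v) auto
    finally show ?thesis .
  qed
  then have "(\<integral>\<^sup>+x. epow (v x) (DIM('a) / (DIM('a) - 1)) \<partial>lborel)
     \<le> (\<integral>\<^sup>+x. (\<Prod>i\<in>Basis. epow (\<integral>\<^sup>+t. f (x + (t - x \<bullet> i) *\<^sub>R i) \<partial>lborel) ?q) \<partial>lborel)"
    by (intro nn_integral_mono)
  also note nn_integral_grid_lines_lborel[OF f N]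
  finally show ?thesis .
qed

section \<open>The Sobolev inequality for continuously differentiable functions\<close>

definition gradient :: "('a::euclidean_space \<Rightarrow> real) \<Rightarrow> 'a \<Rightarrow> 'a" where
  "gradient u x = (\<Sum>i\<in>Basis. partial_deriv i u x *\<^sub>R i)"

lemma gradient_inner_Basis: "i \<in> Basis \<Longrightarrow> gradient u x \<bullet> i = partial_deriv i u x"
  by (simp add: gradient_def)

lemma abs_partial_deriv_le_gradient: "i \<in> Basis \<Longrightarrow> \<bar>partial_deriv i u x\<bar> \<le> norm (gradient u x)"
  by (metis gradient_inner_Basis Basis_le_norm)

lemma has_real_derivative_abs_powr:
  fixes s \<gamma> :: real assumes "1 < \<gamma>"
  shows "((\<lambda>s. \<bar>s\<bar> powr \<gamma>) has_real_derivative \<gamma> * (\<bar>s\<bar> powr (\<gamma> - 1) * sgn s)) (at s)"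
proof (cases "s = 0")
  case True
  have "((\<lambda>h::real. \<bar>h\<bar> powr (\<gamma> - 1)) \<longlongrightarrow> 0) (at 0)"
    using assms by (intro tendsto_zero_powrI[where b="\<gamma> - 1"] tendsto_rabs_zero tendsto_ident_at) (auto intro!: tendsto_eq_intros)
  moreover have "norm ((\<bar>h\<bar> powr \<gamma>) / h) \<le> \<bar>h\<bar> powr (\<gamma> - 1)" for h :: real
    by (simp add: powr_diff)
  ultimately have "((\<lambda>h::real. (\<bar>h\<bar> powr \<gamma>) / h) \<longlongrightarrow> 0) (at 0)"
    by (auto intro: Lim_null_comparison[OF always_eventually, rotated])
  then show ?thesis using True by (simp add: DERIV_def)
next
  case False
  have "((\<lambda>s. \<bar>s\<bar>) has_real_derivative sgn s) (at s)"
  proof (cases "0 < s")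
    case True
    show ?thesis
      by (rule has_field_derivative_transform_within_open[of "\<lambda>x. x" _ _ "{0<..}"])
        (use True in \<open>auto intro!: derivative_eq_intros\<close>)
  next
    case neg: False
    show ?thesis
      by (rule has_field_derivative_transform_within_open[of "\<lambda>x. - x" _ _ "{..<0}"])
        (use neg False in \<open>auto intro!: derivative_eq_intros\<close>)
  qed
  then have "((\<lambda>s. (\<bar>s\<bar>) powr \<gamma>) has_real_derivative \<gamma> * (\<bar>s\<bar> powr (\<gamma> - 1)) * sgn s) (at s)"
    using False by (intro DERIV_chain2[where f="\<lambda>x. x powr \<gamma>"] has_real_derivative_powr) auto
  then show ?thesis by (simp add: mult.assoc)
qed

lemma isCont_abs_powr_sgn:
  fixes s a :: real assumes "0 < a"
  shows "isCont (\<lambda>s. \<bar>s\<bar> powr a * sgn s) s"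
proof (cases "s = 0")
  case True
  have "((\<lambda>h::real. \<bar>h\<bar> powr a) \<longlongrightarrow> 0) (at 0)"
    using assms by (intro tendsto_zero_powrI[where b=a] tendsto_rabs_zero tendsto_ident_at) (auto intro!: tendsto_eq_intros)
  moreover have "norm (\<bar>h\<bar> powr a * sgn h) \<le> \<bar>h\<bar> powr a" for h :: real
    by (simp add: sgn_if abs_mult)
  ultimately have "((\<lambda>h::real. \<bar>h\<bar> powr a * sgn h) \<longlongrightarrow> 0) (at 0)"
    by (auto intro: Lim_null_comparison[OF always_eventually, rotated])
  then show ?thesis using True by (simp add: isCont_def)
next
  case False
  then show ?thesis by (intro continuous_intros) auto
qed

lemma has_real_derivative_along_line:
  fixes u :: "'a::euclidean_space \<Rightarrow> real"
  assumes "u differentiable at (y + t *\<^sub>R i)"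
  shows "((\<lambda>t. u (y + t *\<^sub>R i)) has_real_derivative partial_deriv i u (y + t *\<^sub>R i)) (at t)"
proof -
  have "(u has_derivative frechet_derivative u (at (y + t *\<^sub>R i))) (at (y + t *\<^sub>R i))"
    using assms by (simp add: frechet_derivative_works)
  then have "((\<lambda>t. u (y + t *\<^sub>R i)) has_derivative (\<lambda>h. frechet_derivative u (at (y + t *\<^sub>R i)) (h *\<^sub>R i))) (at t)"
    by (rule has_derivative_compose[rotated]) (auto intro!: derivative_eq_intros)
  moreover have "frechet_derivative u (at (y + t *\<^sub>R i)) (h *\<^sub>R i) = partial_deriv i u (y + t *\<^sub>R i) * h" for h
    unfolding partial_deriv_def using linear_frechet_derivative[OF assms] by (simp add: linear_scale)
  ultimately show ?thesis by (simp add: has_field_derivative_def)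
qed

text \<open>
  The function \<open>\<bar>u\<bar> powr \<gamma>\<close> is differentiable along lines because \<open>\<gamma> > 1\<close>, and it vanishes far away. So its
  value at a point is the integral of its derivative over a half line, and a partial derivative of
  \<open>u\<close> is bounded by the norm of the gradient.
\<close>

lemma abs_powr_le_line_integral:
  fixes u :: "'a::euclidean_space \<Rightarrow> real"
  assumes diff: "\<And>x. u differentiable at x" and i: "i \<in> Basis" and cont: "continuous_on UNIV (partial_deriv i u)"
    and supp: "bounded {x. u x \<noteq> 0}" and \<gamma>: "1 < \<gamma>"
  shows "ennreal (\<bar>u x\<bar> powr \<gamma>) \<le>
    (\<integral>\<^sup>+t. (\<lambda>y. ennreal (\<gamma> * (\<bar>u y\<bar> powr (\<gamma> - 1) * norm (gradient u y)))) (x + (t - x \<bullet> i) *\<^sub>R i) \<partial>lborel)"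
proof -
  define w where "w t = u (x + (t - x \<bullet> i) *\<^sub>R i)" for t
  define d where "d t = partial_deriv i u (x + (t - x \<bullet> i) *\<^sub>R i)" for t
  define h where "h t = \<gamma> * (\<bar>w t\<bar> powr (\<gamma> - 1) * sgn (w t)) * d t" for t
  have w_eq: "w = (\<lambda>t. u ((x - (x \<bullet> i) *\<^sub>R i) + t *\<^sub>R i))" "d = (\<lambda>t. partial_deriv i u ((x - (x \<bullet> i) *\<^sub>R i) + t *\<^sub>R i))"
    by (auto simp: w_def d_def algebra_simps)
  have w': "(w has_real_derivative d t) (at t)" for t
    unfolding w_eq by (rule has_real_derivative_along_line) (rule diff)
  have H: "((\<lambda>t. \<bar>w t\<bar> powr \<gamma>) has_real_derivative h t) (at t)" for t
    unfolding h_def by (rule DERIV_chain2[OF has_real_derivative_abs_powr[OF \<gamma>] w'])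
  have d_cont: "isCont d t" for t
  proof -
    have "continuous_on UNIV d" unfolding w_eq
      by (intro continuous_on_compose2[OF cont] continuous_intros) auto
    then show ?thesis by (simp add: continuous_on_eq_continuous_at)
  qed
  have h_cont: "isCont h t" for t
    unfolding h_def
    by (intro continuous_intros d_cont isCont_o2[OF DERIV_isCont[OF w'] isCont_abs_powr_sgn]) (use \<gamma> in auto)
  obtain R where R: "\<And>y. u y \<noteq> 0 \<Longrightarrow> norm y \<le> R"
    using supp unfolding bounded_iff by auto
  \<comment> \<open>A parameter before x on the line at which the line has left the support of u.\<close>
  define a where "a = min (- R - 1) (x \<bullet> i)"
  have "w a = 0"
  proof (rule ccontr)
    assume "w a \<noteq> 0"
    then have "norm (x + (a - x \<bullet> i) *\<^sub>R i) \<le> R" unfolding w_def by (rule R)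
    then have "\<bar>(x + (a - x \<bullet> i) *\<^sub>R i) \<bullet> i\<bar> \<le> R" using Basis_le_norm[OF i] order_trans by blast
    then have "\<bar>a\<bar> \<le> R" using i by (simp add: inner_left_distrib)
    then show False unfolding a_def by auto
  qed
  have le: "a \<le> x \<bullet> i" by (simp add: a_def)
  have "\<bar>u x\<bar> powr \<gamma> = \<bar>w (x \<bullet> i)\<bar> powr \<gamma> - \<bar>w a\<bar> powr \<gamma>"
    using \<open>w a = 0\<close> by (simp add: w_def)
  also have "\<dots> = (\<integral>t. h t * indicator {a..x \<bullet> i} t \<partial>lborel)"
    using integral_FTC_Icc_real[OF le H h_cont] by simp
  finally have "ennreal (\<bar>u x\<bar> powr \<gamma>) \<le> ennreal (norm (\<integral>t. h t * indicator {a..x \<bullet> i} t \<partial>lborel))"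
    by (intro ennreal_leI) simp
  also have "\<dots> \<le> (\<integral>\<^sup>+t. norm (h t * indicator {a..x \<bullet> i} t) \<partial>lborel)"
    by (intro integral_norm_bound_ennreal)
      (use has_bochner_integral_FTC_Icc_real[OF le H h_cont] in \<open>auto intro: integrable.intros\<close>)
  also have "\<dots> \<le> (\<integral>\<^sup>+t. (\<lambda>y. ennreal (\<gamma> * (\<bar>u y\<bar> powr (\<gamma> - 1) * norm (gradient u y)))) (x + (t - x \<bullet> i) *\<^sub>R i) \<partial>lborel)"
  proof (intro nn_integral_mono ennreal_leI)
    fix t
    have "norm (h t * indicator {a..x \<bullet> i} t) \<le> \<bar>h t\<bar>"
      by (auto simp: indicator_def)
    also have "\<dots> = \<gamma> * (\<bar>w t\<bar> powr (\<gamma> - 1) * \<bar>d t\<bar>)"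
      using \<gamma> by (auto simp: h_def abs_mult abs_sgn_eq)
    also have "\<dots> \<le> \<gamma> * (\<bar>w t\<bar> powr (\<gamma> - 1) * norm (gradient u (x + (t - x \<bullet> i) *\<^sub>R i)))"
      unfolding d_def using \<gamma> by (intro mult_left_mono abs_partial_deriv_le_gradient i) auto
    finally show "norm (h t * indicator {a..x \<bullet> i} t)
       \<le> \<gamma> * (\<bar>u (x + (t - x \<bullet> i) *\<^sub>R i)\<bar> powr (\<gamma> - 1) * norm (gradient u (x + (t - x \<bullet> i) *\<^sub>R i)))"
      by (simp add: w_def)
  qed
  finally show ?thesis .
qed

lemma nn_integral_finite_of_bounded_support:
  fixes f :: "'a::euclidean_space \<Rightarrow> real"
  assumes "\<And>x. f x \<le> B" and supp: "bounded {x. f x \<noteq> 0}"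
  shows "(\<integral>\<^sup>+x. ennreal (f x) \<partial>lborel) < \<infinity>"
proof -
  obtain a where a: "{x. f x \<noteq> 0} \<subseteq> cbox (-a) a"
    using bounded_subset_cbox_symmetric[OF supp] by auto
  have "f x = 0" if "x \<notin> cbox (-a) a" for x
    using a that by blast
  then have "(\<integral>\<^sup>+x. ennreal (f x) \<partial>lborel) \<le> (\<integral>\<^sup>+x. ennreal B * indicator (cbox (-a) a) x \<partial>lborel)"
    using assms(1) by (intro nn_integral_mono) (auto simp: indicator_def intro!: ennreal_leI)
  also have "\<dots> = ennreal B * emeasure lborel (cbox (-a) a)"
    by (subst nn_integral_cmult) auto
  also have "\<dots> < \<infinity>"
    using emeasure_lborel_cbox_finite[of "-a" a] by (simp add: ennreal_mult_less_top)
  finally show ?thesis .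
qed

lemma bounded_of_continuous_bounded_support:
  fixes u :: "'a::euclidean_space \<Rightarrow> real"
  assumes "continuous_on UNIV u" "bounded {x. u x \<noteq> 0}"
  obtains B where "0 \<le> B" "\<And>x. \<bar>u x\<bar> \<le> B"
proof -
  obtain a where a: "{x. u x \<noteq> 0} \<subseteq> cbox (-a) a"
    using bounded_subset_cbox_symmetric[OF assms(2)] by auto
  have "compact (u ` cbox (-a) a)"
    using assms(1) by (intro compact_continuous_image) (auto intro: continuous_on_subset)
  then obtain B where "\<And>x. x \<in> cbox (-a) a \<Longrightarrow> \<bar>u x\<bar> \<le> B"
    using compact_imp_bounded[of "u ` cbox (-a) a"] by (auto simp: bounded_iff)
  then have "\<bar>u x\<bar> \<le> \<bar>B\<bar>" for x
    using a by (cases "u x = 0") fastforce+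
  then show ?thesis by (intro that[of "\<bar>B\<bar>"]) auto
qed

text \<open>
  The Gagliardo-Nirenberg-Sobolev inequality. The case of exponent \<open>1\<close> is applied to \<open>\<bar>u\<bar> powr \<gamma>\<close> with
  \<open>\<gamma> = p (N - 1) / (N - p)\<close>. This choice makes the power \<open>\<gamma> N / (N - 1)\<close> on the left equal to the critical
  exponent, and in the integral of \<open>\<bar>u\<bar> powr (\<gamma> - 1)\<close> times the norm of the gradient Hoelder's inequality
  yields the same integral of the critical power once more, in the power \<open>1 - 1 / p\<close>. That smaller
  power can be absorbed in the left-hand side.
\<close>

theorem Sobolev_inequality:
  fixes u :: "'a::euclidean_space \<Rightarrow> real" and p :: real
  defines "ps \<equiv> critical_exponent (real DIM('a)) p"
  assumes N: "DIM('a) \<ge> 2" and p: "1 < p" "p < DIM('a)"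
    and diff: "\<And>x. u differentiable at x" and cont: "\<And>i. i \<in> Basis \<Longrightarrow> continuous_on UNIV (partial_deriv i u)"
    and supp: "bounded {x. u x \<noteq> 0}"
  shows "(\<integral>\<^sup>+x. ennreal (\<bar>u x\<bar> powr ps) \<partial>lborel)
    \<le> ennreal ((p * (real DIM('a) - 1) / (real DIM('a) - p)) powr ps) * epow (\<integral>\<^sup>+x. ennreal (norm (gradient u x) powr p) \<partial>lborel) (ps / p)"
proof -
  define n where "n = real DIM('a)"
  have n: "real (DIM('a) - 1) = n - 1" "1 < n" "p < n" using N p by (auto simp: n_def of_nat_diff)
  define \<gamma> where "\<gamma> = p * (n - 1) / (n - p)"
  have \<gamma>: "1 < \<gamma>" using n p by (simp add: \<gamma>_def field_simps)
  have ps: "ps = n * p / (n - p)" "0 < ps" using n p by (auto simp: ps_def critical_exponent_def n_def)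
  have e1: "\<gamma> * (n / (n - 1)) = ps" using n p by (simp add: \<gamma>_def ps)
  have e2: "ps * (1 - 1 / p) = \<gamma> - 1" using n p by (simp add: \<gamma>_def ps field_simps)
  have e3: "((n - 1) / n - (1 - 1 / p)) * ps = 1" using n p by (simp add: ps field_simps)
  have u_cont: "continuous_on UNIV u"
    using diff by (auto simp: continuous_on_eq_continuous_at intro: differentiable_imp_continuous_within)
  have [measurable]: "u \<in> borel_measurable borel" 
    using u_cont by (rule borel_measurable_continuous_onI)
  have [measurable]: "gradient u \<in> borel_measurable borel"
    using cont unfolding gradient_def[abs_def] by (intro borel_measurable_continuous_onI continuous_intros) auto
  define A where "A = (\<integral>\<^sup>+x. ennreal (\<bar>u x\<bar> powr ps) \<partial>lborel)"
  define B where "B = (\<integral>\<^sup>+x. ennreal (norm (gradient u x) powr p) \<partial>lborel)"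
  let ?f = "\<lambda>y. ennreal (\<gamma> * (\<bar>u y\<bar> powr (\<gamma> - 1) * norm (gradient u y)))"
  have "A = (\<integral>\<^sup>+x. epow (ennreal (\<bar>u x\<bar> powr \<gamma>)) (DIM('a) / (DIM('a) - 1)) \<partial>lborel)"
  proof -
    have "epow (ennreal (\<bar>u x\<bar> powr \<gamma>)) (n / (n - 1)) = ennreal (\<bar>u x\<bar> powr ps)" for x
      unfolding e1[symmetric] powr_powr[symmetric] using n by (intro epow_ennreal) auto
    then show ?thesis unfolding A_def using n by (simp add: n_def)
  qed
  also have "\<dots> \<le> epow (\<integral>\<^sup>+x. ?f x \<partial>lborel) (DIM('a) / (DIM('a) - 1))"
    by (rule Gagliardo_Nirenberg) (use N abs_powr_le_line_integral[OF diff _ cont supp \<gamma>] in auto)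
  also have "real DIM('a) / real (DIM('a) - 1) = n / (n - 1)"
    using n by (simp add: n_def)
  also have "(\<integral>\<^sup>+x. ?f x \<partial>lborel) = ennreal \<gamma> * (\<integral>\<^sup>+x. epow (ennreal (\<bar>u x\<bar> powr ps)) (1 - 1/p) * epow (ennreal (norm (gradient u x) powr p)) (1/p) \<partial>lborel)"
    using \<gamma> p by (subst nn_integral_cmult[symmetric])
      (auto simp: epow_ennreal powr_powr e2 simp flip: ennreal_mult intro!: nn_integral_cong)
  also have "epow \<dots> (n / (n - 1)) \<le> epow (ennreal \<gamma> * (epow A (1 - 1/p) * epow B (1/p))) (n / (n - 1))"
    unfolding A_def B_def using p n
    by (intro epow_mono mult_left_mono nn_integral_Holder_two) auto
  finally have AB: "A \<le> epow (ennreal \<gamma> * (epow A (1 - 1/p) * epow B (1/p))) (n / (n - 1))" .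
  \<comment> \<open>Absorbing A in the left-hand side requires that it is finite.\<close>
  have "A < \<infinity>"
  proof -
    obtain C where C: "0 \<le> C" "\<And>x. \<bar>u x\<bar> \<le> C"
      using bounded_of_continuous_bounded_support[OF u_cont supp] by auto
    show ?thesis unfolding A_def
      by (rule nn_integral_finite_of_bounded_support[of _ "C powr ps"]) (use C ps supp in \<open>auto intro!: powr_mono2\<close>)
  qed
  then obtain \<alpha> where \<alpha>: "A = ennreal \<alpha>" "0 \<le> \<alpha>" by (cases A) auto
  have "A \<le> ennreal (\<gamma> powr ps) * epow B (ps / p)"
  proof (cases "B = top")
    case True
    moreover have "ps / p \<noteq> 0" "ennreal (\<gamma> powr ps) \<noteq> 0" using ps(2) p \<gamma> by auto
    ultimately show ?thesis by (simp add: epow_top ennreal_mult_top)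
  next
    case False
    then obtain \<beta> where \<beta>: "B = ennreal \<beta>" "0 \<le> \<beta>" by (cases B) auto
    show ?thesis
    proof (cases "\<alpha> = 0")
      case False
      then have "\<alpha> > 0" using \<alpha> by simp
      have "ennreal \<alpha> \<le> ennreal ((\<gamma> * (\<alpha> powr (1 - 1/p) * \<beta> powr (1/p))) powr (n / (n - 1)))"
        using AB \<alpha> \<beta> \<gamma> p n by (simp add: epow_ennreal flip: ennreal_mult)
      then have "\<alpha> \<le> (\<gamma> * (\<alpha> powr (1 - 1/p) * \<beta> powr (1/p))) powr (n / (n - 1))"
        by simp
      then have "\<alpha> powr ((n - 1) / n) \<le> ((\<gamma> * (\<alpha> powr (1 - 1/p) * \<beta> powr (1/p))) powr (n / (n - 1))) powr ((n - 1) / n)"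
        using \<alpha> n by (intro powr_mono2) auto
      also have "\<dots> = \<gamma> * (\<alpha> powr (1 - 1/p) * \<beta> powr (1/p))"
        using n \<gamma> by (simp add: powr_powr)
      finally have le: "\<alpha> powr ((n - 1) / n) \<le> \<gamma> * (\<alpha> powr (1 - 1/p) * \<beta> powr (1/p))" .
      have "\<alpha> powr ((n - 1) / n - (1 - 1/p)) \<le> \<gamma> * \<beta> powr (1/p)"
      proof -
        have "\<alpha> powr ((n - 1) / n) = \<alpha> powr ((n - 1) / n - (1 - 1/p)) * \<alpha> powr (1 - 1/p)"
          by (simp add: powr_add[symmetric])
        with le have "\<alpha> powr ((n - 1) / n - (1 - 1/p)) * \<alpha> powr (1 - 1/p) \<le> (\<gamma> * \<beta> powr (1/p)) * \<alpha> powr (1 - 1/p)"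
          by (simp only: mult_ac)
        then show ?thesis
          by (rule mult_right_le_imp_le) (use \<open>\<alpha> > 0\<close> in simp)
      qed
      then have "(\<alpha> powr ((n - 1) / n - (1 - 1/p))) powr ps \<le> (\<gamma> * \<beta> powr (1/p)) powr ps"
        using ps by (intro powr_mono2) auto
      then have "\<alpha> \<le> \<gamma> powr ps * \<beta> powr (ps / p)"
        using \<gamma> \<alpha> by (simp add: powr_powr e3 powr_mult)
      moreover have "ps / p \<noteq> 0" using ps(2) p by auto
      ultimately show ?thesis
        using \<alpha> \<beta> by (simp add: epow_ennreal ennreal_leI flip: ennreal_mult)
    qed (simp add: \<alpha>)
  qed
  then show ?thesis unfolding A_def B_def \<gamma>_def n_def .
qed

section \<open>Smooth bump functions\<close>

lemma partial_deriv_eqI: "(f has_derivative f') (at x) \<Longrightarrow> partial_deriv i f x = f' i"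
  unfolding partial_deriv_def by (metis frechet_derivative_at)

text \<open>
  The recursion for \<open>Suc k\<close> refers only to the partial derivatives, not to the function as an element
  of the class of order \<open>k\<close>. This inclusion is what closes the induction in the product rule.
\<close>

lemma continuously_differentiable_Suc_imp:
  "continuously_differentiable (Suc k) f \<Longrightarrow> continuously_differentiable k f"
proof (induction k arbitrary: f)
  case 0
  then show ?case
    by (auto simp: continuous_on_eq_continuous_at intro: differentiable_imp_continuous_within)
next
  case (Suc k)
  then show ?case by (metis continuously_differentiable.simps(2))
qed

lemma continuously_differentiable_const: "continuously_differentiable k (\<lambda>x. c)"
proof (induction k arbitrary: c)
  case (Suc k)
  have "partial_deriv i (\<lambda>x. c) = (\<lambda>x::'a. 0)" for i :: 'a
    by (rule ext, rule partial_deriv_eqI) (rule has_derivative_const)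
  then show ?case using Suc by simp
qed simp

lemma continuously_differentiable_add:
  "continuously_differentiable k f \<Longrightarrow> continuously_differentiable k g \<Longrightarrow>
    continuously_differentiable k (\<lambda>x. f x + g x)"
proof (induction k arbitrary: f g)
  case (Suc k)
  have "partial_deriv i (\<lambda>x. f x + g x) = (\<lambda>x. partial_deriv i f x + partial_deriv i g x)" for i
    using Suc.prems unfolding partial_deriv_def[of i f] partial_deriv_def[of i g]
    by (intro ext partial_deriv_eqI has_derivative_add) (auto simp: frechet_derivative_works)
  then show ?case using Suc by simp
qed (auto intro: continuous_intros)

lemma continuously_differentiable_mult:
  "continuously_differentiable k f \<Longrightarrow> continuously_differentiable k g \<Longrightarrow>
    continuously_differentiable k (\<lambda>x. f x * g x)"
proof (induction k arbitrary: f g)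
  case (Suc k)
  have "partial_deriv i (\<lambda>x. f x * g x) = (\<lambda>x. f x * partial_deriv i g x + partial_deriv i f x * g x)" for i
    using Suc.prems unfolding partial_deriv_def[of i f] partial_deriv_def[of i g]
    by (intro ext partial_deriv_eqI has_derivative_mult) (auto simp: frechet_derivative_works)
  then show ?case using Suc continuously_differentiable_Suc_imp[OF Suc.prems(1)]
      continuously_differentiable_Suc_imp[OF Suc.prems(2)]
    by (auto intro!: continuously_differentiable_add)
qed (auto intro: continuous_intros)

lemma continuously_differentiable_prod:
  "finite A \<Longrightarrow> (\<And>a. a \<in> A \<Longrightarrow> continuously_differentiable k (f a)) \<Longrightarrow>
    continuously_differentiable k (\<lambda>x. \<Prod>a\<in>A. f a x)"
  by (induction A rule: finite_induct)
    (auto intro: continuously_differentiable_const continuously_differentiable_mult)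

text \<open>
  The family \<open>(1 / t) ^ n * exp (- 1 / t)\<close> for \<open>t > 0\<close>, extended by \<open>0\<close>. Up to linear combinations it is closed
  under differentiation, so that \<open>flat_exp 0\<close> is seen to be smooth by a single induction over all \<open>n\<close>.
\<close>

definition flat_exp :: "nat \<Rightarrow> real \<Rightarrow> real" where
  "flat_exp n t = (if 0 < t then (1 / t) ^ n * exp (- (1 / t)) else 0)"

lemma flat_exp_tendsto_0: "(flat_exp n \<longlongrightarrow> 0) (at 0)"
proof -
  have "((\<lambda>t. (1 / t) ^ n / exp (1 / t)) \<longlongrightarrow> (0::real)) (at_right 0)"
    by (rule filterlim_compose[OF tendsto_power_div_exp_0, of "\<lambda>t. 1 / t"])
      (simp add: filterlim_inverse_at_top_right flip: inverse_eq_divide)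
  then have "(flat_exp n \<longlongrightarrow> 0) (at_right 0)"
    by (rule Lim_transform_eventually)
      (auto simp: flat_exp_def eventually_at_right_less exp_minus divide_inverse intro: eventually_mono[OF eventually_at_right_less])
  moreover have "(flat_exp n \<longlongrightarrow> 0) (at_left 0)"
    by (rule tendsto_eventually) (auto simp: flat_exp_def eventually_at_filter)
  ultimately show ?thesis by (simp add: filterlim_split_at)
qed

lemma DERIV_flat_exp:
  "(flat_exp n has_real_derivative flat_exp (n + 2) t - real n * flat_exp (n + 1) t) (at t)"
proof -
  consider "t < 0" | "t = 0" | "t > 0" by linarith
  then show ?thesis
  proof cases
    case 1
    have "(flat_exp n has_real_derivative 0) (at t)"
      by (rule has_field_derivative_transform_within_open[of "\<lambda>x. 0" _ _ "{..<0}"])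
        (use 1 in \<open>auto simp: flat_exp_def\<close>)
    then show ?thesis using 1 by (simp add: flat_exp_def)
  next
    case 2
    have "(\<lambda>h. (flat_exp n (0 + h) - flat_exp n 0) / h) = flat_exp (Suc n)"
      by (auto simp: flat_exp_def fun_eq_iff)
    then have "(flat_exp n has_real_derivative 0) (at 0)"
      using flat_exp_tendsto_0[of "Suc n"] by (simp add: DERIV_def)
    then show ?thesis using 2 by (simp add: flat_exp_def)
  next
    case 3
    have inv: "((\<lambda>t. 1 / t) has_real_derivative - (1 / t)\<^sup>2) (at t)"
      using 3 by (auto intro!: derivative_eq_intros simp: field_simps power2_eq_square)
    have "((\<lambda>t. (1 / t) ^ n) has_real_derivative - real n * (1 / t) ^ (n + 1)) (at t)"
    proof (cases n)
      case (Suc k)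
      have "(1 + real k) * (- s\<^sup>2 * s ^ k) = - real (Suc k) * s ^ (Suc k + 1)" for s :: real
        by (simp add: power2_eq_square algebra_simps)
      then show ?thesis
        unfolding Suc by (rule DERIV_cong[OF DERIV_power_Suc[OF inv]])
    qed simp
    moreover have "((\<lambda>t. exp (- (1 / t))) has_real_derivative exp (- (1 / t)) * (1 / t)\<^sup>2) (at t)"
      using DERIV_fun_exp[OF DERIV_minus[OF inv]] by simp
    ultimately have prod_rule: "((\<lambda>t. (1 / t) ^ n * exp (- (1 / t))) has_real_derivative
        - real n * (1 / t) ^ (n + 1) * exp (- (1 / t)) + exp (- (1 / t)) * (1 / t)\<^sup>2 * (1 / t) ^ n) (at t)"
      by (rule DERIV_mult)
    have "- real n * s ^ (n + 1) * e + e * s\<^sup>2 * s ^ n = s ^ (n + 2) * e - real n * (s ^ (n + 1) * e)" for s e :: real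
      by (simp add: power2_eq_square)
    then have "((\<lambda>t. (1 / t) ^ n * exp (- (1 / t))) has_real_derivative
        (1 / t) ^ (n + 2) * exp (- (1 / t)) - real n * ((1 / t) ^ (n + 1) * exp (- (1 / t)))) (at t)"
      by (rule DERIV_cong[OF prod_rule])
    then have "(flat_exp n has_real_derivative 
        (1 / t) ^ (n + 2) * exp (- (1 / t)) - real n * ((1 / t) ^ (n + 1) * exp (- (1 / t)))) (at t)"
      by (rule has_field_derivative_transform_within_open[of _ _ _ "{0<..}"])
        (use 3 in \<open>auto simp: flat_exp_def\<close>)
    then show ?thesis using 3 by (simp add: flat_exp_def)
  qed
qed

lemma continuously_differentiable_flat_exp_affine:
  "continuously_differentiable k (\<lambda>x. flat_exp n (x \<bullet> v + c))"
proof (induction k arbitrary: n)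
  case 0
  have "continuous_on UNIV (flat_exp n)"
    using DERIV_flat_exp by (intro DERIV_continuous_on) (auto intro: has_field_derivative_at_within)
  then show ?case
    by (auto intro!: continuous_on_compose2[of UNIV "flat_exp n"] continuous_intros)
next
  case (Suc k)
  have D: "((\<lambda>x. flat_exp n (x \<bullet> v + c)) has_derivative
     (\<lambda>h. (flat_exp (n + 2) (x \<bullet> v + c) - real n * flat_exp (n + 1) (x \<bullet> v + c)) * (h \<bullet> v))) (at x)" for x
    by (rule has_derivative_compose[OF _ DERIV_flat_exp[unfolded has_field_derivative_def]])
      (auto intro!: derivative_eq_intros)
  have "partial_deriv i (\<lambda>x. flat_exp n (x \<bullet> v + c)) =
    (\<lambda>x. (flat_exp (n + 2) (x \<bullet> v + c) + (- real n) * flat_exp (n + 1) (x \<bullet> v + c)) * (i \<bullet> v))" for i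
    using partial_deriv_eqI[OF D] by (simp add: fun_eq_iff)
  then have "continuously_differentiable k (partial_deriv i (\<lambda>x. flat_exp n (x \<bullet> v + c)))" for i
    by (simp only:) (intro continuously_differentiable_add continuously_differentiable_mult
        continuously_differentiable_const Suc.IH)
  moreover have "(\<lambda>x. flat_exp n (x \<bullet> v + c)) differentiable (at x)" for x
    using D differentiableI by blast
  ultimately show ?case by simp
qed

text \<open>
  Since \<open>flat_exp 0 (m * t) = exp (- 1 / (m * t))\<close> for \<open>t > 0\<close>, scaling the argument by \<open>m\<close> makes these
  functions converge to the indicator of the open box as \<open>m\<close> tends to infinity. The arguments are written
  as affine functions of \<open>x\<close> to make the smoothness of the factors immediate.
\<close>

definition box_bump :: "'a::euclidean_space \<Rightarrow> 'a \<Rightarrow> real \<Rightarrow> 'a \<Rightarrow> real" where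
  "box_bump a b m x = (\<Prod>i\<in>Basis. flat_exp 0 (x \<bullet> (m *\<^sub>R i) + - m * (a \<bullet> i)) * flat_exp 0 (x \<bullet> (- m *\<^sub>R i) + m * (b \<bullet> i)))"

lemma smooth_box_bump: "smooth (box_bump a b m)"
  unfolding smooth_def box_bump_def[abs_def]
  by (intro allI continuously_differentiable_prod continuously_differentiable_mult
      continuously_differentiable_flat_exp_affine) auto

lemma flat_exp_0_bounds: "0 \<le> flat_exp 0 t" "flat_exp 0 t \<le> 1"
  by (auto simp: flat_exp_def)

lemma box_bump_bounds: "0 \<le> box_bump a b m x" "box_bump a b m x \<le> 1"
  unfolding box_bump_def
  by (auto intro!: prod_nonneg prod_le_1 mult_le_one flat_exp_0_bounds mult_nonneg_nonneg)

lemma box_bump_eq_0: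
  assumes "x \<notin> box a b" "m > 0" shows "box_bump a b m x = 0"
proof -
  obtain i where "i \<in> Basis" "\<not> (a \<bullet> i < x \<bullet> i \<and> x \<bullet> i < b \<bullet> i)"
    using assms by (auto simp: mem_box)
  moreover then have "flat_exp 0 (x \<bullet> (m *\<^sub>R i) + - m * (a \<bullet> i)) * flat_exp 0 (x \<bullet> (- m *\<^sub>R i) + m * (b \<bullet> i)) = 0"
    using assms(2) by (auto simp: flat_exp_def not_less)
  ultimately show ?thesis unfolding box_bump_def
    by (intro prod_zero) auto
qed

lemma box_bump_tendsto_1:
  assumes "x \<in> box a b" shows "(\<lambda>m. box_bump a b (real (Suc m)) x) \<longlonglongrightarrow> 1"
proof -
  have lim: "(\<lambda>m. flat_exp 0 (real (Suc m) * r)) \<longlonglongrightarrow> 1" if "r > 0" for r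
  proof -
    have "(\<lambda>m. inverse (real (Suc m)) * (1 / r)) \<longlonglongrightarrow> 0 * (1 / r)"
      by (intro tendsto_mult LIMSEQ_inverse_real_of_nat tendsto_const)
    then have "(\<lambda>m. exp (- (inverse (real (Suc m)) * (1 / r)))) \<longlonglongrightarrow> exp (- 0)"
      by (intro tendsto_intros) simp
    moreover have "flat_exp 0 (real (Suc m) * r) = exp (- (inverse (real (Suc m)) * (1 / r)))" for m
      using that by (simp add: flat_exp_def divide_inverse del: of_nat_Suc)
    ultimately show ?thesis by simp
  qed
  have "(\<lambda>m. box_bump a b (real (Suc m)) x) \<longlonglongrightarrow> (\<Prod>i\<in>(Basis::'a set). 1 * 1)"
    unfolding box_bump_def
  proof (intro tendsto_prod tendsto_mult)
    fix i :: 'a assume i: "i \<in> Basis"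
    have *: "x \<bullet> (real (Suc m) *\<^sub>R i) + - real (Suc m) * (a \<bullet> i) = real (Suc m) * (x \<bullet> i - a \<bullet> i)"
      "x \<bullet> (- real (Suc m) *\<^sub>R i) + real (Suc m) * (b \<bullet> i) = real (Suc m) * (b \<bullet> i - x \<bullet> i)" for m
      by (simp_all add: algebra_simps del: of_nat_Suc)
    have pos: "0 < x \<bullet> i - a \<bullet> i" "0 < b \<bullet> i - x \<bullet> i"
      using assms i by (auto simp: mem_box)
    show "(\<lambda>m. flat_exp 0 (x \<bullet> (real (Suc m) *\<^sub>R i) + - real (Suc m) * (a \<bullet> i))) \<longlonglongrightarrow> 1"
      unfolding * by (rule lim[OF pos(1)])
    show "(\<lambda>m. flat_exp 0 (x \<bullet> (- real (Suc m) *\<^sub>R i) + real (Suc m) * (b \<bullet> i))) \<longlonglongrightarrow> 1"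
      unfolding * by (rule lim[OF pos(2)])
  qed
  then show ?thesis by simp
qed

lemma test_function_box_bump:
  assumes "cbox a b \<subseteq> \<Omega>" "m > 0" shows "test_function \<Omega> (box_bump a b m)"
proof -
  have "{x. box_bump a b m x \<noteq> 0} \<subseteq> box a b"
    using box_bump_eq_0[OF _ assms(2)] by blast
  also have "\<dots> \<subseteq> cbox a b" by (rule box_subset_cbox)
  finally have "closure {x. box_bump a b m x \<noteq> 0} \<subseteq> cbox a b"
    by (rule closure_minimal) (rule closed_cbox)
  moreover then have "compact (closure {x. box_bump a b m x \<noteq> 0})"
    by (meson bounded_cbox bounded_subset closed_closure compact_eq_bounded_closed)
  ultimately show ?thesis using assms(1) smooth_box_bump by (auto simp: test_function_def)
qed

section \<open>The fundamental lemma of the calculus of variations\<close>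

text \<open>
  Test against bumps that converge boundedly to the indicator of the box.
\<close>

lemma integral_cbox_eq_0_of_test_functions:
  fixes h :: "'a::euclidean_space \<Rightarrow> real"
  assumes box: "cbox a b \<subseteq> \<Omega>" and \<Omega>: "open \<Omega>" and h: "integrable (lebesgue_on (cbox a b)) h"
    and zero: "\<And>\<phi>. test_function \<Omega> \<phi> \<Longrightarrow> (\<integral>x. h x * \<phi> x \<partial>lebesgue_on \<Omega>) = 0"
  shows "integral (cbox a b) h = 0"
proof -
  have [simp]: "\<Omega> \<in> sets lebesgue" using \<Omega> by (simp add: borel_open)
  have hi: "integrable lebesgue (\<lambda>x. indicator (cbox a b) x *\<^sub>R h x)"
    using h by (simp add: integrable_restrict_space)
  have cont: "continuous_on UNIV (box_bump a b m)" for m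
    using smooth_box_bump unfolding smooth_def by (metis continuously_differentiable.simps(1))
  have box_ind: "indicator (box a b) x *\<^sub>R (indicator (cbox a b) x *\<^sub>R h x) = indicator (box a b) x *\<^sub>R h x" for x
    using box_subset_cbox[of a b] by (cases "x \<in> box a b") auto
  have box_int: "integrable lebesgue (\<lambda>x. indicator (box a b) x *\<^sub>R h x)"
    unfolding box_ind[symmetric] by (rule integrable_mult_indicator[OF _ hi]) simp
  let ?s = "\<lambda>m x. (indicator (cbox a b) x *\<^sub>R h x) * box_bump a b (real (Suc m)) x"
  have s0: "(\<integral>x. ?s m x \<partial>lebesgue) = 0" for m
  proof -
    have "(\<integral>x. ?s m x \<partial>lebesgue) = (\<integral>x. indicator \<Omega> x *\<^sub>R (h x * box_bump a b (real (Suc m)) x) \<partial>lebesgue)"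
    proof (intro Bochner_Integration.integral_cong refl)
      fix x
      show "?s m x = indicator \<Omega> x *\<^sub>R (h x * box_bump a b (real (Suc m)) x)"
        using box box_bump_eq_0[of x a b "real (Suc m)"] box_subset_cbox[of a b]
        by (cases "x \<in> box a b") (auto simp: indicator_def simp del: of_nat_Suc)
    qed
    also have "\<dots> = (\<integral>x. h x * box_bump a b (real (Suc m)) x \<partial>lebesgue_on \<Omega>)"
      by (simp add: integral_restrict_space)
    also have "\<dots> = 0" by (intro zero test_function_box_bump box) simp
    finally show ?thesis .
  qed
  have "(\<lambda>m. \<integral>x. ?s m x \<partial>lebesgue) \<longlonglongrightarrow> (\<integral>x. indicator (box a b) x *\<^sub>R h x \<partial>lebesgue)"
  proof (rule integral_dominated_convergence)
    show "integrable lebesgue (\<lambda>x. norm (indicator (cbox a b) x *\<^sub>R h x))"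
      using hi by (rule integrable_norm)
    show "(\<lambda>x. indicator (box a b) x *\<^sub>R h x) \<in> borel_measurable lebesgue"
      using box_int by (rule borel_measurable_integrable)
    show "?s m \<in> borel_measurable lebesgue" for m
      using borel_measurable_integrable[OF hi]
      by (intro borel_measurable_times) 
        (auto intro!: measurable_completion borel_measurable_continuous_onI cont simp del: of_nat_Suc)
    show "AE x in lebesgue. (\<lambda>m. ?s m x) \<longlonglongrightarrow> indicator (box a b) x *\<^sub>R h x"
    proof (rule AE_I2)
      fix x
      show "(\<lambda>m. ?s m x) \<longlonglongrightarrow> indicator (box a b) x *\<^sub>R h x"
      proof (cases "x \<in> box a b")
        case True
        then have "x \<in> cbox a b" using box_subset_cbox by blast
        moreover have "(\<lambda>m. h x * box_bump a b (real (Suc m)) x) \<longlonglongrightarrow> h x * 1"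
          by (intro tendsto_intros box_bump_tendsto_1 True)
        ultimately show ?thesis using True by (simp del: of_nat_Suc)
      next
        case False
        then show ?thesis using box_bump_eq_0[OF False] by (simp del: of_nat_Suc)
      qed
    qed
    show "AE x in lebesgue. norm (?s m x) \<le> norm (indicator (cbox a b) x *\<^sub>R h x)" for m
      using box_bump_bounds[of a b "real (Suc m)"]
      by (intro AE_I2) (auto simp: abs_mult mult_left_le simp del: of_nat_Suc)
  qed
  then have "(\<integral>x. indicator (box a b) x *\<^sub>R h x \<partial>lebesgue) = 0"
    unfolding s0 by (rule LIMSEQ_unique[OF _ tendsto_const])
  then have "(\<integral>x. h x \<partial>lebesgue_on (box a b)) = 0"
    by (simp add: integral_restrict_space)
  moreover have "integrable (lebesgue_on (box a b)) h"
    using box_int by (simp add: integrable_restrict_space)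
  ultimately have "integral (box a b) h = 0"
    by (simp add: lebesgue_integral_eq_integral)
  then show ?thesis by (simp add: integral_open_interval)
qed

text \<open>
  By Lebesgue differentiation, \<open>h\<close> is almost everywhere the limit of its averages over small cubes with
  corner \<open>x\<close>, and these averages vanish as soon as the cubes lie inside the given box.
\<close>

lemma negligible_nonzero_of_integral_cbox_eq_0:
  fixes h :: "'a::euclidean_space \<Rightarrow> real"
  assumes h: "h integrable_on cbox A B"
    and zero: "\<And>a b. cbox a b \<subseteq> cbox A B \<Longrightarrow> integral (cbox a b) h = 0"
  shows "negligible {x \<in> cbox A B. h x \<noteq> 0}"
proof -
  \<comment> \<open>The differentiation theorem is about functions that are integrable over all boxes.\<close>
  define f where "f x = (if x \<in> cbox A B then h x else 0)" for x
  have "f integrable_on UNIV"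
    using h unfolding f_def by (simp add: integrable_restrict_UNIV)
  then have "f integrable_on cbox a b" for a b
    by (rule integrable_on_subcbox) simp
  then obtain N where N: "negligible N" and lim: "\<And>x e. x \<notin> N \<Longrightarrow> 0 < e \<Longrightarrow>
      \<exists>d>0. \<forall>r. 0 < r \<and> r < d \<longrightarrow> norm (integral (cbox x (x + r *\<^sub>R One)) f /\<^sub>R r ^ DIM('a) - f x) < e"
    using integrable_ccontinuous_explicit[of f] by metis
  have "h x = 0" if x: "x \<in> box A B" "x \<notin> N" for x
  proof (rule ccontr)
    assume "h x \<noteq> 0"
    then obtain d where d: "d > 0" "\<And>r. 0 < r \<Longrightarrow> r < d \<Longrightarrow> norm (integral (cbox x (x + r *\<^sub>R One)) f /\<^sub>R r ^ DIM('a) - f x) < norm (h x)"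
      using lim[OF x(2), of "norm (h x)"] by auto
    have "((\<lambda>r. x + r *\<^sub>R One) \<longlongrightarrow> x + 0 *\<^sub>R One) (at_right 0)"
      by (intro tendsto_intros)
    then have "\<forall>\<^sub>F r in at_right 0. x + r *\<^sub>R One \<in> box A B"
      using x(1) by (intro topological_tendstoD) auto
    moreover have "\<forall>\<^sub>F r in at_right 0. r < d" "\<forall>\<^sub>F r in at_right (0::real). r > 0"
      using d(1) by (auto simp: eventually_at_right_less eventually_at_right_field)
    ultimately have "\<forall>\<^sub>F r in at_right (0::real). False"
    proof eventually_elim
      case (elim r)
      have sub: "cbox x (x + r *\<^sub>R One) \<subseteq> cbox A B"
        using elim(1) x(1) by (auto simp: subset_box mem_box less_imp_le)
      have "integral (cbox x (x + r *\<^sub>R One)) f = integral (cbox x (x + r *\<^sub>R One)) h"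
        using sub by (intro integral_cong) (auto simp: f_def)
      also have "\<dots> = 0" by (rule zero[OF sub])
      finally have "norm (f x) < norm (h x)" using d(2)[OF elim(3,2)] by simp
      then show False using x(1) box_subset_cbox by (auto simp: f_def split: if_splits)
    qed
    then show False by simp
  qed
  then have "{x \<in> cbox A B. h x \<noteq> 0} \<subseteq> N \<union> (cbox A B - box A B)" by auto
  moreover have "negligible (N \<union> (cbox A B - box A B))"
    using N by (simp add: negligible_Un negligible_frontier_interval)
  ultimately show ?thesis by (rule negligible_subset[rotated])
qed

text \<open>
  An open set is covered by countably many closed boxes that it contains, and on each of them \<open>h\<close> has
  vanishing integral over all smaller boxes.
\<close>

lemma AE_zero_of_test_functions:
  fixes h :: "'a::euclidean_space \<Rightarrow> real"
  assumes \<Omega>: "open \<Omega>" and h: "locally_integrable \<Omega> h"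
    and zero: "\<And>\<phi>. test_function \<Omega> \<phi> \<Longrightarrow> (\<integral>x. h x * \<phi> x \<partial>lebesgue_on \<Omega>) = 0"
  shows "AE x in lebesgue_on \<Omega>. h x = 0"
proof -
  obtain \<D> where \<D>: "countable \<D>" "\<D> \<subseteq> Pow \<Omega>" "\<And>X. X \<in> \<D> \<Longrightarrow> \<exists>a b. X = cbox a b" "\<Union>\<D> = \<Omega>"
    using open_countable_Union_open_cbox[OF \<Omega>] by metis
  have "negligible {x \<in> X. h x \<noteq> 0}" if X_mem: "X \<in> \<D>" for X
  proof -
    obtain a b where X: "X = cbox a b" using \<D>(3)[OF X_mem] by auto
    have int: "integrable (lebesgue_on (cbox c d)) h" if "cbox c d \<subseteq> \<Omega>" for c d
      using h that unfolding locally_integrable_def by auto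
    have sub: "cbox a b \<subseteq> \<Omega>" using X_mem \<D>(2) X by auto
    show ?thesis unfolding X
    proof (rule negligible_nonzero_of_integral_cbox_eq_0)
      show "h integrable_on cbox a b"
        using int[OF sub] by (intro integrable_on_lebesgue_on) auto
      show "integral (cbox c d) h = 0" if "cbox c d \<subseteq> cbox a b" for c d
        using that sub int[of c d] by (intro integral_cbox_eq_0_of_test_functions[OF _ \<Omega> _ zero]) auto
    qed
  qed
  then have "negligible (\<Union>X\<in>\<D>. {x \<in> X. h x \<noteq> 0})"
    using \<D>(1) by (intro negligible_countable_Union) auto
  moreover have "(\<Union>X\<in>\<D>. {x \<in> X. h x \<noteq> 0}) = {x \<in> \<Omega>. h x \<noteq> 0}" using \<D>(4) by auto
  ultimately have "{x \<in> \<Omega>. h x \<noteq> 0} \<in> null_sets lebesgue"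
    by (simp add: negligible_iff_null_sets)
  then have "AE x in lebesgue. x \<in> \<Omega> \<longrightarrow> h x = 0"
    by (rule AE_I') auto
  then show ?thesis using \<Omega> by (simp add: AE_restrict_space_iff borel_open)
qed

section \<open>Weak gradients\<close>

lemma integrable_mult_compact_support:
  fixes f \<psi> :: "'a::euclidean_space \<Rightarrow> real"
  assumes \<Omega>: "open \<Omega>" and f: "locally_integrable \<Omega> f" and \<psi>: "continuous_on UNIV \<psi>"
    and K: "compact K" "K \<subseteq> \<Omega>" and supp: "\<And>x. x \<notin> K \<Longrightarrow> \<psi> x = 0"
  shows "integrable (lebesgue_on \<Omega>) (\<lambda>x. f x * \<psi> x)"
proof -
  have [simp]: "K \<in> sets lebesgue" "\<Omega> \<in> sets lebesgue"
    using K \<Omega> by (auto simp: borel_open borel_closed compact_imp_closed)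
  have "{x. \<psi> x \<noteq> 0} \<subseteq> K" using supp by blast
  then have "bounded {x. \<psi> x \<noteq> 0}"
    using K(1) bounded_subset compact_imp_bounded by blast
  then obtain B where B: "0 \<le> B" "\<And>x. \<bar>\<psi> x\<bar> \<le> B"
    using bounded_of_continuous_bounded_support[OF \<psi>] by auto
  have "integrable (lebesgue_on K) f"
    using f K by (auto simp: locally_integrable_def)
  then have fK: "integrable lebesgue (\<lambda>x. indicator K x *\<^sub>R f x)"
    by (simp add: integrable_restrict_space)
  have "integrable lebesgue (\<lambda>x. (indicator K x *\<^sub>R f x) * \<psi> x)"
  proof (rule Bochner_Integration.integrable_bound[OF integrable_mult_right[OF fK, of B]])
    show "(\<lambda>x. (indicator K x *\<^sub>R f x) * \<psi> x) \<in> borel_measurable lebesgue"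
      by (intro borel_measurable_times borel_measurable_integrable[OF fK] measurable_completion)
        (use \<psi> in \<open>auto intro: borel_measurable_continuous_onI\<close>)
    show "AE x in lebesgue. norm ((indicator K x *\<^sub>R f x) * \<psi> x) \<le> norm (B * (indicator K x *\<^sub>R f x))"
    proof (rule AE_I2)
      fix x
      have "\<bar>indicator K x *\<^sub>R f x\<bar> * \<bar>\<psi> x\<bar> \<le> \<bar>indicator K x *\<^sub>R f x\<bar> * B"
        by (intro mult_left_mono B) simp
      then show "norm ((indicator K x *\<^sub>R f x) * \<psi> x) \<le> norm (B * (indicator K x *\<^sub>R f x))"
        using B(1) by (simp only: real_norm_def abs_mult abs_of_nonneg mult.commute)
    qed
  qed
  moreover have "(\<lambda>x. (indicator K x *\<^sub>R f x) * \<psi> x) = (\<lambda>x. indicator \<Omega> x *\<^sub>R (f x * \<psi> x))"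
  proof (rule ext)
    fix x show "(indicator K x *\<^sub>R f x) * \<psi> x = indicator \<Omega> x *\<^sub>R (f x * \<psi> x)"
      using K(2) supp[of x] by (cases "x \<in> K") auto
  qed
  ultimately show ?thesis by (simp add: integrable_restrict_space)
qed

lemma test_functionD:
  assumes "test_function \<Omega> \<phi>"
  shows "\<phi> differentiable (at x)" "continuous_on UNIV \<phi>"
    and "i \<in> Basis \<Longrightarrow> continuous_on UNIV (partial_deriv i \<phi>)"
    and "bounded {x. \<phi> x \<noteq> 0}"
proof -
  have "continuously_differentiable (Suc 0) \<phi>" "continuously_differentiable 0 \<phi>"
    using assms unfolding test_function_def smooth_def by blast+
  then show "\<phi> differentiable (at x)" "continuous_on UNIV \<phi>"
    and "i \<in> Basis \<Longrightarrow> continuous_on UNIV (partial_deriv i \<phi>)" by auto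
  show "bounded {x. \<phi> x \<noteq> 0}"
    using assms unfolding test_function_def
    by (meson bounded_subset closure_subset compact_imp_bounded)
qed

lemma partial_deriv_eq_0_outside_support:
  assumes "x \<notin> closure {x. f x \<noteq> 0}" shows "partial_deriv i f x = 0"
proof -
  have "(f has_derivative (\<lambda>_. 0)) (at x)"
    by (rule has_derivative_transform_within_open[of "\<lambda>_. 0" _ _ _ "- closure {x. f x \<noteq> 0}"])
      (use assms closure_subset[of "{x. f x \<noteq> 0}"] in auto)
  then show ?thesis by (rule partial_deriv_eqI)
qed

lemma integrable_mult_test_function:
  fixes f :: "'a::euclidean_space \<Rightarrow> real"
  assumes "open \<Omega>" "locally_integrable \<Omega> f" and \<phi>: "test_function \<Omega> \<phi>"
  shows "integrable (lebesgue_on \<Omega>) (\<lambda>x. f x * \<phi> x)"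
    and "i \<in> Basis \<Longrightarrow> integrable (lebesgue_on \<Omega>) (\<lambda>x. f x * partial_deriv i \<phi> x)"
proof -
  have K: "compact (closure {x. \<phi> x \<noteq> 0})" "closure {x. \<phi> x \<noteq> 0} \<subseteq> \<Omega>"
    using \<phi> by (auto simp: test_function_def)
  have "\<phi> x = 0" if "x \<notin> closure {x. \<phi> x \<noteq> 0}" for x
    using that closure_subset[of "{x. \<phi> x \<noteq> 0}"] by auto
  then show "integrable (lebesgue_on \<Omega>) (\<lambda>x. f x * \<phi> x)"
    by (rule integrable_mult_compact_support[OF assms(1,2) test_functionD(2)[OF \<phi>] K])
  show "integrable (lebesgue_on \<Omega>) (\<lambda>x. f x * partial_deriv i \<phi> x)" if "i \<in> Basis"
    by (rule integrable_mult_compact_support[OF assms(1,2) test_functionD(3)[OF \<phi> that] K])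
      (rule partial_deriv_eq_0_outside_support)
qed

lemma locally_integrable_inner:
  "locally_integrable \<Omega> g \<Longrightarrow> locally_integrable \<Omega> (\<lambda>x. g x \<bullet> i)"
  by (auto simp: locally_integrable_def)

lemma locally_integrable_diff:
  "locally_integrable \<Omega> f \<Longrightarrow> locally_integrable \<Omega> g \<Longrightarrow> locally_integrable \<Omega> (\<lambda>x. f x - g x)"
  by (auto simp: locally_integrable_def)

text \<open>
  This identifies \<^const>\<open>weak_gradient\<close>, which is obtained by choice, with any weak gradient at hand.
\<close>

lemma weak_gradient_unique:
  fixes \<Omega> :: "'a::euclidean_space set"
  assumes \<Omega>: "open \<Omega>" and g: "has_weak_gradient \<Omega> u g" and k: "has_weak_gradient \<Omega> u k"
  shows "AE x in lebesgue_on \<Omega>. g x = k x"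
proof -
  have li: "locally_integrable \<Omega> (\<lambda>x. g x \<bullet> i)" "locally_integrable \<Omega> (\<lambda>x. k x \<bullet> i)" for i
    using g k by (auto simp: has_weak_gradient_def intro: locally_integrable_inner)
  have "AE x in lebesgue_on \<Omega>. g x \<bullet> i - k x \<bullet> i = 0" if i: "i \<in> Basis" for i
  proof (rule AE_zero_of_test_functions[OF \<Omega>])
    show "locally_integrable \<Omega> (\<lambda>x. g x \<bullet> i - k x \<bullet> i)"
      by (intro locally_integrable_diff li)
    fix \<phi> assume \<phi>: "test_function \<Omega> \<phi>"
    have "(\<integral>x. (g x \<bullet> i - k x \<bullet> i) * \<phi> x \<partial>lebesgue_on \<Omega>)
      = (\<integral>x. (g x \<bullet> i) * \<phi> x \<partial>lebesgue_on \<Omega>) - (\<integral>x. (k x \<bullet> i) * \<phi> x \<partial>lebesgue_on \<Omega>)"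
      unfolding left_diff_distrib
      by (intro Bochner_Integration.integral_diff integrable_mult_test_function[OF \<Omega> _ \<phi>] li)
    also have "\<dots> = 0"
      using g k \<phi> i unfolding has_weak_gradient_def by fastforce
    finally show "(\<integral>x. (g x \<bullet> i - k x \<bullet> i) * \<phi> x \<partial>lebesgue_on \<Omega>) = 0" .
  qed
  then have "AE x in lebesgue_on \<Omega>. \<forall>i\<in>Basis. g x \<bullet> i - k x \<bullet> i = 0"
    by (intro AE_finite_allI) auto
  then show ?thesis
    by eventually_elim (auto intro: euclidean_eqI)
qed

lemma has_weak_gradient_diff:
  assumes \<Omega>: "open \<Omega>" and u: "has_weak_gradient \<Omega> u g" and v: "has_weak_gradient \<Omega> v k"
  shows "has_weak_gradient \<Omega> (\<lambda>x. u x - v x) (\<lambda>x. g x - k x)"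
  unfolding has_weak_gradient_def
proof (intro conjI allI impI ballI)
  have li: "locally_integrable \<Omega> u" "locally_integrable \<Omega> v" "locally_integrable \<Omega> g" "locally_integrable \<Omega> k"
    using u v by (auto simp: has_weak_gradient_def)
  then show "locally_integrable \<Omega> (\<lambda>x. u x - v x)" "locally_integrable \<Omega> (\<lambda>x. g x - k x)"
    by (auto intro: locally_integrable_diff)
  fix \<phi> and i :: 'a assume \<phi>: "test_function \<Omega> \<phi>" and i: "i \<in> Basis"
  have "(\<integral>x. (u x - v x) * partial_deriv i \<phi> x \<partial>lebesgue_on \<Omega>)
    = (\<integral>x. u x * partial_deriv i \<phi> x \<partial>lebesgue_on \<Omega>) - (\<integral>x. v x * partial_deriv i \<phi> x \<partial>lebesgue_on \<Omega>)"
    unfolding left_diff_distrib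
    by (intro Bochner_Integration.integral_diff integrable_mult_test_function(2)[OF \<Omega> _ \<phi> i] li)
  also have "\<dots> = - ((\<integral>x. (g x \<bullet> i) * \<phi> x \<partial>lebesgue_on \<Omega>) - (\<integral>x. (k x \<bullet> i) * \<phi> x \<partial>lebesgue_on \<Omega>))"
    using u v \<phi> i unfolding has_weak_gradient_def by fastforce
  also have "(\<integral>x. (g x \<bullet> i) * \<phi> x \<partial>lebesgue_on \<Omega>) - (\<integral>x. (k x \<bullet> i) * \<phi> x \<partial>lebesgue_on \<Omega>)
    = (\<integral>x. ((g x - k x) \<bullet> i) * \<phi> x \<partial>lebesgue_on \<Omega>)"
    unfolding left_diff_distrib inner_diff_left
    by (intro Bochner_Integration.integral_diff[symmetric] integrable_mult_test_function(1)[OF \<Omega> _ \<phi>]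
        locally_integrable_inner li)
  finally show "(\<integral>x. (u x - v x) * partial_deriv i \<phi> x \<partial>lebesgue_on \<Omega>)
    = - (\<integral>x. ((g x - k x) \<bullet> i) * \<phi> x \<partial>lebesgue_on \<Omega>)" .
qed

lemma integrable_continuous_bounded_support:
  fixes f :: "'a::euclidean_space \<Rightarrow> real"
  assumes "continuous_on UNIV f" "bounded {x. f x \<noteq> 0}"
  shows "integrable lborel f"
proof -
  obtain a where a: "{x. f x \<noteq> 0} \<subseteq> cbox (-a) a"
    using bounded_subset_cbox_symmetric[OF assms(2)] by auto
  have "integrable lborel (\<lambda>x. indicator (cbox (-a) a) x *\<^sub>R f x)"
    by (rule borel_integrable_compact) (use assms(1) continuous_on_subset in auto)
  moreover have "(\<lambda>x. indicator (cbox (-a) a) x *\<^sub>R f x) = f"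
  proof (rule ext)
    fix x show "indicator (cbox (-a) a) x *\<^sub>R f x = f x"
      using a by (cases "f x = 0") auto
  qed
  ultimately show ?thesis by simp
qed

lemma integral_translation_lborel:
  fixes f :: "'a::euclidean_space \<Rightarrow> real"
  assumes [measurable]: "f \<in> borel_measurable borel"
  shows "(\<integral>x. f (x + c) \<partial>lborel) = (\<integral>x. f x \<partial>lborel)"
proof -
  have "(\<integral>x. f x \<partial>lborel) = (\<integral>x. f x \<partial>distr lborel borel (\<lambda>x. c + x))"
    using lborel_affine[of 1 c] by (simp add: density_1)
  also have "\<dots> = (\<integral>x. f (c + x) \<partial>lborel)"
    by (rule integral_distr) auto
  finally show ?thesis by (simp add: add.commute)
qed

text \<open>
  The integrals of the difference quotients vanish by translation invariance. The quotients converge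
  to the partial derivative and are dominated: they are bounded by the mean value theorem, and for
  steps of length at most \<open>1\<close> they vanish outside a fixed ball.
\<close>

lemma integral_partial_deriv_eq_0:
  fixes w :: "'a::euclidean_space \<Rightarrow> real"
  assumes diff: "\<And>x. w differentiable (at x)" and i: "i \<in> Basis"
    and cont: "continuous_on UNIV (partial_deriv i w)" and supp: "bounded {x. w x \<noteq> 0}"
  shows "(\<integral>x. partial_deriv i w x \<partial>lborel) = 0"
proof -
  have w_cont: "continuous_on UNIV w"
    using diff by (auto simp: continuous_on_eq_continuous_at intro: differentiable_imp_continuous_within)
  have [measurable]: "w \<in> borel_measurable borel" "partial_deriv i w \<in> borel_measurable borel"
    using w_cont cont by (auto intro: borel_measurable_continuous_onI)
  have w_int: "integrable lborel w"
    by (rule integrable_continuous_bounded_support[OF w_cont supp])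
  obtain R where R: "\<And>x. w x \<noteq> 0 \<Longrightarrow> norm x \<le> R"
    using supp unfolding bounded_iff by auto
  have "bounded {x. partial_deriv i w x \<noteq> 0}"
    by (rule bounded_subset[OF bounded_closure[OF supp]]) (use partial_deriv_eq_0_outside_support in blast)
  then obtain B where B: "0 \<le> B" "\<And>x. \<bar>partial_deriv i w x\<bar> \<le> B"
    using bounded_of_continuous_bounded_support[OF cont] by auto
  define t where "t n = inverse (real (Suc n))" for n
  have t: "0 < t n" "t n \<le> 1" for n by (auto simp: t_def field_simps)
  have t0: "t \<longlonglongrightarrow> 0" unfolding t_def by (rule LIMSEQ_inverse_real_of_nat)
  let ?q = "\<lambda>n x. (w (x + t n *\<^sub>R i) - w x) / t n"
  have line: "((\<lambda>s. w (x + s *\<^sub>R i)) has_real_derivative partial_deriv i w (x + s *\<^sub>R i)) (at s)" for x s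
    by (rule has_real_derivative_along_line) (rule diff)
  have bound: "\<bar>?q n x\<bar> \<le> B * indicator (cball 0 (R + 1)) x" for n x
  proof (cases "x \<in> cball 0 (R + 1)")
    case True
    obtain z where "w (x + t n *\<^sub>R i) - w (x + 0 *\<^sub>R i) = (t n - 0) * partial_deriv i w (x + z *\<^sub>R i)"
      using MVT2[OF t(1)[of n], of "\<lambda>s. w (x + s *\<^sub>R i)" "\<lambda>s. partial_deriv i w (x + s *\<^sub>R i)"] line by auto
    then have "?q n x = partial_deriv i w (x + z *\<^sub>R i)" using t(1)[of n] by simp
    then show ?thesis using True B by simp
  next
    case False
    then have nx: "norm x > R + 1" by simp
    then have "w x = 0" using R[of x] by force
    moreover have "w (x + t n *\<^sub>R i) = 0"
    proof (rule ccontr)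
      assume "w (x + t n *\<^sub>R i) \<noteq> 0"
      then have "norm (x + t n *\<^sub>R i) \<le> R" by (rule R)
      moreover have "norm x \<le> norm (x + t n *\<^sub>R i) + norm (t n *\<^sub>R i)"
        by (metis add_diff_cancel_right' norm_triangle_ineq4)
      ultimately show False using nx t[of n] i by simp
    qed
    ultimately show ?thesis using False by simp
  qed
  have "(\<lambda>n. \<integral>x. ?q n x \<partial>lborel) \<longlonglongrightarrow> (\<integral>x. partial_deriv i w x \<partial>lborel)"
  proof (rule integral_dominated_convergence)
    have "integrable lborel (indicator (cball (0::'a) (R + 1)) :: 'a \<Rightarrow> real)"
      using emeasure_bounded_finite[of "cball (0::'a) (R + 1)"] by (simp add: integrable_indicator_iff)
    then show "integrable lborel (\<lambda>x. B * indicator (cball (0::'a) (R + 1)) x)"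
      by (rule integrable_mult_right)
    show "AE x in lborel. norm (?q n x) \<le> B * indicator (cball 0 (R + 1)) x" for n
      using bound by simp
    show "AE x in lborel. (\<lambda>n. ?q n x) \<longlonglongrightarrow> partial_deriv i w x"
    proof (rule AE_I2)
      fix x
      have "((\<lambda>h. (w (x + h *\<^sub>R i) - w x) / h) \<longlongrightarrow> partial_deriv i w x) (at 0)"
        using line[of x 0] by (simp add: DERIV_def)
      moreover have "filterlim t (at 0) sequentially"
        using t0 t(1) by (auto simp: filterlim_at less_imp_neq[symmetric])
      ultimately show "(\<lambda>n. ?q n x) \<longlonglongrightarrow> partial_deriv i w x"
        by (rule filterlim_compose)
    qed
  qed measurable
  moreover have "(\<integral>x. ?q n x \<partial>lborel) = 0" for n
  proof -
    have "integrable lborel (\<lambda>x. w (x + t n *\<^sub>R i))"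
    proof (rule integrable_continuous_bounded_support)
      show "continuous_on UNIV (\<lambda>x. w (x + t n *\<^sub>R i))"
        by (intro continuous_on_compose2[OF w_cont] continuous_intros) auto
      have "{x. w (x + t n *\<^sub>R i) \<noteq> 0} \<subseteq> (\<lambda>x. - (t n *\<^sub>R i) + x) ` {x. w x \<noteq> 0}"
        by (auto simp: image_iff intro!: exI[of _ "_ + t n *\<^sub>R i"])
      then show "bounded {x. w (x + t n *\<^sub>R i) \<noteq> 0}"
        using bounded_translation[OF supp] bounded_subset by blast
    qed
    then have "(\<integral>x. w (x + t n *\<^sub>R i) - w x \<partial>lborel) = 0"
      using w_int by (simp add: integral_translation_lborel)
    then show ?thesis by simp
  qed
  ultimately have "(\<lambda>n. 0) \<longlonglongrightarrow> (\<integral>x. partial_deriv i w x \<partial>lborel)"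
    by (simp only:)
  then show ?thesis by (rule LIMSEQ_unique[OF _ tendsto_const])
qed

lemma integral_lebesgue_on_supported:
  fixes f :: "'a::euclidean_space \<Rightarrow> real"
  assumes "open \<Omega>" "f \<in> borel_measurable borel" "\<And>x. x \<notin> \<Omega> \<Longrightarrow> f x = 0"
  shows "(\<integral>x. f x \<partial>lebesgue_on \<Omega>) = (\<integral>x. f x \<partial>lborel)"
proof -
  have "(\<lambda>x. indicator \<Omega> x *\<^sub>R f x) = f"
    using assms(3) by (auto simp: fun_eq_iff indicator_def)
  then show ?thesis
    using assms(1,2) by (simp add: integral_restrict_space borel_open integral_completion)
qed

lemma nn_integral_lebesgue_on_supported:
  fixes f :: "'a::euclidean_space \<Rightarrow> ennreal"
  assumes "open \<Omega>" "\<And>x. x \<notin> \<Omega> \<Longrightarrow> f x = 0"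
  shows "(\<integral>\<^sup>+x. f x \<partial>lebesgue_on \<Omega>) = (\<integral>\<^sup>+x. f x \<partial>lborel)"
proof -
  have "(\<lambda>x. f x * indicator \<Omega> x) = f"
    using assms(2) by (auto simp: fun_eq_iff indicator_def)
  then show ?thesis
    using assms(1) by (simp add: nn_integral_restrict_space borel_open nn_integral_completion)
qed

text \<open>
  Integration by parts for two test functions: the integral of the partial derivative of their
  product vanishes.
\<close>

lemma has_weak_gradient_test_function:
  fixes \<Omega> :: "'a::euclidean_space set"
  assumes \<Omega>: "open \<Omega>" and \<phi>: "test_function \<Omega> \<phi>"
  shows "has_weak_gradient \<Omega> \<phi> (gradient \<phi>)"
  unfolding has_weak_gradient_def
proof (intro conjI allI impI ballI)
  have li: "locally_integrable \<Omega> f" if "continuous_on UNIV f" for f :: "'a \<Rightarrow> 'b::euclidean_space"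
    unfolding locally_integrable_def
  proof (intro allI impI)
    fix K :: "'a set" assume K: "compact K \<and> K \<subseteq> \<Omega>"
    then have "integrable lborel (\<lambda>x. indicator K x *\<^sub>R f x)"
      by (intro borel_integrable_compact) (use that continuous_on_subset in auto)
    then have "integrable lebesgue (\<lambda>x. indicator K x *\<^sub>R f x)"
      by (subst integrable_completion) auto
    then show "integrable (lebesgue_on K) f"
      using K by (simp add: integrable_restrict_space borel_closed compact_imp_closed)
  qed
  show "locally_integrable \<Omega> \<phi>"
    by (rule li) (rule test_functionD(2)[OF \<phi>])
  show "locally_integrable \<Omega> (gradient \<phi>)"
    unfolding gradient_def[abs_def] by (intro li continuous_intros test_functionD(3)[OF \<phi>])
  fix \<psi> and i :: 'a assume \<psi>: "test_function \<Omega> \<psi>" and i: "i \<in> Basis"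
  have [measurable]: "\<phi> \<in> borel_measurable borel" "\<psi> \<in> borel_measurable borel"
    "partial_deriv i \<phi> \<in> borel_measurable borel" "partial_deriv i \<psi> \<in> borel_measurable borel"
    using test_functionD(2,3)[OF \<phi>] test_functionD(2,3)[OF \<psi>] i
    by (auto intro: borel_measurable_continuous_onI)
  have z: "\<psi> x = 0" "partial_deriv i \<psi> x = 0" if "x \<notin> \<Omega>" for x
    using \<psi> that closure_subset[of "{x. \<psi> x \<noteq> 0}"] partial_deriv_eq_0_outside_support[of x \<psi> i]
    by (auto simp: test_function_def)
  have D: "partial_deriv i (\<lambda>x. \<phi> x * \<psi> x) x = \<phi> x * partial_deriv i \<psi> x + partial_deriv i \<phi> x * \<psi> x" for x
    using test_functionD(1)[OF \<phi>] test_functionD(1)[OF \<psi>]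
    unfolding partial_deriv_def[of i \<phi>] partial_deriv_def[of i \<psi>]
    by (intro partial_deriv_eqI has_derivative_mult) (auto simp: frechet_derivative_works)
  have int: "integrable lborel (\<lambda>x. \<phi> x * partial_deriv i \<psi> x)" "integrable lborel (\<lambda>x. partial_deriv i \<phi> x * \<psi> x)"
    by (intro integrable_continuous_bounded_support continuous_intros
        test_functionD(2,3)[OF \<phi>] test_functionD(2,3)[OF \<psi>] i,
        force intro: bounded_subset[OF test_functionD(4)[OF \<phi>]],
        intro integrable_continuous_bounded_support continuous_intros
        test_functionD(2,3)[OF \<phi>] test_functionD(2,3)[OF \<psi>] i,
        force intro: bounded_subset[OF test_functionD(4)[OF \<psi>]])
  have "(\<integral>x. partial_deriv i (\<lambda>x. \<phi> x * \<psi> x) x \<partial>lborel) = 0"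
  proof (rule integral_partial_deriv_eq_0[OF _ i])
    show "(\<lambda>x. \<phi> x * \<psi> x) differentiable (at x)" for x
      by (intro differentiable_mult test_functionD(1)[OF \<phi>] test_functionD(1)[OF \<psi>])
    show "continuous_on UNIV (partial_deriv i (\<lambda>x. \<phi> x * \<psi> x))"
      unfolding D[abs_def] 
      by (intro continuous_intros test_functionD(2,3)[OF \<phi>] test_functionD(2,3)[OF \<psi>] i)
    show "bounded {x. \<phi> x * \<psi> x \<noteq> 0}"
      by (rule bounded_subset[OF test_functionD(4)[OF \<psi>]]) auto
  qed
  then have "(\<integral>x. \<phi> x * partial_deriv i \<psi> x \<partial>lborel) = - (\<integral>x. partial_deriv i \<phi> x * \<psi> x \<partial>lborel)"
    unfolding D using int by (simp add: Bochner_Integration.integral_add)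
  moreover have "(\<integral>x. \<phi> x * partial_deriv i \<psi> x \<partial>lebesgue_on \<Omega>) = (\<integral>x. \<phi> x * partial_deriv i \<psi> x \<partial>lborel)"
    using z by (intro integral_lebesgue_on_supported \<Omega>) auto
  moreover have "(\<integral>x. (gradient \<phi> x \<bullet> i) * \<psi> x \<partial>lebesgue_on \<Omega>) = (\<integral>x. partial_deriv i \<phi> x * \<psi> x \<partial>lborel)"
    unfolding gradient_inner_Basis[OF i]
    using z by (intro integral_lebesgue_on_supported \<Omega>) auto
  ultimately show "(\<integral>x. \<phi> x * partial_deriv i \<psi> x \<partial>lebesgue_on \<Omega>) = - (\<integral>x. (gradient \<phi> x \<bullet> i) * \<psi> x \<partial>lebesgue_on \<Omega>)"
    by simp
qed

section \<open>The Sobolev embedding\<close>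

lemma powr_add_le:
  fixes a b p :: real
  assumes "0 \<le> a" "0 \<le> b" "0 \<le> p"
  shows "(a + b) powr p \<le> 2 powr p * (a powr p + b powr p)"
proof -
  have "(a + b) powr p \<le> (2 * max a b) powr p"
    using assms by (intro powr_mono2) auto
  also have "\<dots> = 2 powr p * max a b powr p"
    using assms by (simp add: powr_mult)
  also have "\<dots> \<le> 2 powr p * (a powr p + b powr p)"
    by (intro mult_left_mono) (auto simp: max_def)
  finally show ?thesis .
qed

lemma norm_diff_powr_le:
  fixes a b :: "'b::real_normed_vector"
  assumes "0 \<le> p"
  shows "norm (a - b) powr p \<le> 2 powr p * (norm a powr p + norm b powr p)"
proof -
  have "norm (a - b) powr p \<le> (norm a + norm b) powr p"
    using assms by (intro powr_mono2 norm_triangle_ineq4) auto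
  also have "\<dots> \<le> 2 powr p * (norm a powr p + norm b powr p)"
    using assms by (intro powr_add_le) auto
  finally show ?thesis .
qed

lemma Lp_norm_powr: "p \<noteq> 0 \<Longrightarrow> Lp_norm \<Omega> p f powr p = (\<integral>x. norm (f x) powr p \<partial>lebesgue_on \<Omega>)"
  by (simp add: Lp_norm_def powr_powr)

lemma Lp_space_diff:
  fixes f g :: "'a::euclidean_space \<Rightarrow> 'b::euclidean_space"
  assumes "f \<in> Lp_space \<Omega> p" "g \<in> Lp_space \<Omega> p" "0 < p"
  shows "(\<lambda>x. f x - g x) \<in> Lp_space \<Omega> p"
proof -
  have [measurable]: "f \<in> borel_measurable (lebesgue_on \<Omega>)" "g \<in> borel_measurable (lebesgue_on \<Omega>)"
    and int: "integrable (lebesgue_on \<Omega>) (\<lambda>x. norm (f x) powr p)" "integrable (lebesgue_on \<Omega>) (\<lambda>x. norm (g x) powr p)"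
    using assms by (auto simp: Lp_space_def)
  have "integrable (lebesgue_on \<Omega>) (\<lambda>x. norm (f x - g x) powr p)"
  proof (rule Bochner_Integration.integrable_bound)
    show "integrable (lebesgue_on \<Omega>) (\<lambda>x. 2 powr p * (norm (f x) powr p + norm (g x) powr p))"
      using int by simp
    show "AE x in lebesgue_on \<Omega>. norm (norm (f x - g x) powr p) \<le> norm (2 powr p * (norm (f x) powr p + norm (g x) powr p))"
      using norm_diff_powr_le[of p "f _" "g _"] assms(3) by (intro AE_I2) simp
  qed measurable
  then show ?thesis by (simp add: Lp_space_def)
qed

lemma continuous_bounded_support_in_Lp_space:
  fixes f :: "'a::euclidean_space \<Rightarrow> 'b::euclidean_space"
  assumes "open \<Omega>" "continuous_on UNIV f" "bounded {x. f x \<noteq> 0}" "0 < p"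
  shows "f \<in> Lp_space \<Omega> p"
proof -
  have [measurable]: "f \<in> borel_measurable borel"
    using assms(2) by (rule borel_measurable_continuous_onI)
  have "continuous_on UNIV (\<lambda>x. norm (f x) powr p)"
    using assms by (intro continuous_on_powr' continuous_intros) auto
  then have "integrable lborel (\<lambda>x. norm (f x) powr p)"
    by (rule integrable_continuous_bounded_support) (use assms(3) in simp)
  then have "integrable lebesgue (\<lambda>x. norm (f x) powr p)"
    by (subst integrable_completion) auto
  then have "integrable lebesgue (\<lambda>x. indicator \<Omega> x *\<^sub>R norm (f x) powr p)"
    using assms(1) by (intro integrable_mult_indicator) (auto simp: borel_open)
  moreover have "f \<in> borel_measurable (lebesgue_on \<Omega>)"
    by (intro measurable_restrict_space1 measurable_completion) simp
  ultimately show ?thesis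
    using assms(1) by (simp add: Lp_space_def integrable_restrict_space borel_open)
qed

lemma borel_measurable_lebesgue_on_AE:
  fixes f g :: "'a::euclidean_space \<Rightarrow> 'b::euclidean_space"
  assumes \<Omega>: "open \<Omega>" and f: "f \<in> borel_measurable (lebesgue_on \<Omega>)" and ae: "AE x in lebesgue_on \<Omega>. f x = g x"
  shows "g \<in> borel_measurable (lebesgue_on \<Omega>)"
proof -
  have s: "\<Omega> \<inter> space lebesgue \<in> sets lebesgue" using \<Omega> by (simp add: borel_open)
  have "AE x in lebesgue. indicator \<Omega> x *\<^sub>R f x = indicator \<Omega> x *\<^sub>R g x"
    using ae unfolding AE_restrict_space_iff[OF s] by eventually_elim (auto simp: indicator_def)
  from borel_measurable_AE[OF _ this] f show ?thesis
    unfolding borel_measurable_restrict_space_iff[OF s] by simp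
qed

lemma test_function_gradient:
  assumes "test_function \<Omega> \<phi>"
  shows "continuous_on UNIV (gradient \<phi>)" "{x. gradient \<phi> x \<noteq> 0} \<subseteq> closure {x. \<phi> x \<noteq> 0}"
    "bounded {x. gradient \<phi> x \<noteq> 0}"
proof -
  show "continuous_on UNIV (gradient \<phi>)"
    unfolding gradient_def[abs_def] by (intro continuous_intros test_functionD(3)[OF assms])
  show *: "{x. gradient \<phi> x \<noteq> 0} \<subseteq> closure {x. \<phi> x \<noteq> 0}"
  proof
    fix x assume "x \<in> {x. gradient \<phi> x \<noteq> 0}"
    then obtain i where "partial_deriv i \<phi> x \<noteq> 0"
      unfolding gradient_def by (cases "\<forall>i. partial_deriv i \<phi> x = 0") auto
    then show "x \<in> closure {x. \<phi> x \<noteq> 0}"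
      using partial_deriv_eq_0_outside_support by blast
  qed
  show "bounded {x. gradient \<phi> x \<noteq> 0}"
    using bounded_subset[OF bounded_closure[OF test_functionD(4)[OF assms]] *] .
qed

text \<open>
  By uniqueness, the chosen weak gradient in the Sobolev norm may be replaced by the difference of a
  weak gradient of \<open>u\<close> and the classical gradient of \<open>\<phi>\<close>. In particular smallness of the norm then really
  controls the gradient of \<open>\<phi>\<close>; for a gradient outside \<open>L\<^sup>p\<close> the integral would have the default value \<open>0\<close>.
\<close>

lemma Sobolev_norm_diff_test_function:
  fixes \<Omega> :: "'a::euclidean_space set"
  assumes \<Omega>: "open \<Omega>" and p: "1 < p" and u: "u \<in> Lp_space \<Omega> p" and g: "g \<in> Lp_space \<Omega> p" "has_weak_gradient \<Omega> u g"
    and \<phi>: "test_function \<Omega> \<phi>"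
  shows "Sobolev_norm \<Omega> p (\<lambda>x. u x - \<phi> x) powr p =
    (\<integral>x. norm (u x - \<phi> x) powr p \<partial>lebesgue_on \<Omega>) + (\<integral>x. norm (g x - gradient \<phi> x) powr p \<partial>lebesgue_on \<Omega>)"
proof -
  have wg: "has_weak_gradient \<Omega> (\<lambda>x. u x - \<phi> x) (\<lambda>x. g x - gradient \<phi> x)"
    by (intro has_weak_gradient_diff \<Omega> g has_weak_gradient_test_function \<phi>)
  let ?G = "weak_gradient \<Omega> (\<lambda>x. u x - \<phi> x)"
  have "has_weak_gradient \<Omega> (\<lambda>x. u x - \<phi> x) ?G"
    unfolding weak_gradient_def by (rule someI[of "has_weak_gradient \<Omega> (\<lambda>x. u x - \<phi> x)", OF wg])
  then have ae: "AE x in lebesgue_on \<Omega>. g x - gradient \<phi> x = ?G x"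
    by (rule weak_gradient_unique[OF \<Omega> wg])
  have "gradient \<phi> \<in> Lp_space \<Omega> p"
    using test_function_gradient[OF \<phi>] p by (intro continuous_bounded_support_in_Lp_space \<Omega>) auto
  then have m: "(\<lambda>x. g x - gradient \<phi> x) \<in> borel_measurable (lebesgue_on \<Omega>)"
    using g(1) by (auto simp: Lp_space_def)
  have mG: "?G \<in> borel_measurable (lebesgue_on \<Omega>)"
    by (rule borel_measurable_lebesgue_on_AE[OF \<Omega> m ae])
  have "(\<integral>x. norm (?G x) powr p \<partial>lebesgue_on \<Omega>) = (\<integral>x. norm (g x - gradient \<phi> x) powr p \<partial>lebesgue_on \<Omega>)"
  proof (rule integral_cong_AE)
    show "AE x in lebesgue_on \<Omega>. norm (?G x) powr p = norm (g x - gradient \<phi> x) powr p"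
      using ae by eventually_elim simp
  qed (use m mG in measurable)
  then show ?thesis
    using p unfolding Sobolev_norm_def by (simp add: Lp_norm_powr powr_powr)
qed

text \<open>
  Test functions \<open>\<phi> n\<close> that approximate \<open>u\<close> have gradients bounded in \<open>L\<^sup>p\<close>, hence are bounded in the
  Lebesgue space of critical exponent by the Sobolev inequality. A subsequence converges to \<open>u\<close> almost everywhere, and
  Fatou's lemma carries the bound over to \<open>u\<close>.
\<close>

theorem Sobolev_embedding:
  fixes \<Omega> :: "'a::euclidean_space set" and p :: real
  assumes N: "DIM('a) \<ge> 2" and p: "1 < p" "p < DIM('a)" and \<Omega>: "open \<Omega>" and u: "u \<in> Sobolev_space_0 \<Omega> p"
  defines "ps \<equiv> critical_exponent (real DIM('a)) p"
  shows "u \<in> Lp_space \<Omega> ps"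
proof -
  have ps: "0 < ps" using p by (auto simp: ps_def critical_exponent_def)
  have uL: "u \<in> Lp_space \<Omega> p" using u by (auto simp: Sobolev_space_0_def Sobolev_space_def)
  then have [measurable]: "u \<in> borel_measurable (lebesgue_on \<Omega>)" by (simp add: Lp_space_def)
  obtain g where g: "g \<in> Lp_space \<Omega> p" "has_weak_gradient \<Omega> u g"
    using u by (auto simp: Sobolev_space_0_def Sobolev_space_def)
  have "\<exists>\<phi>. test_function \<Omega> \<phi> \<and> Sobolev_norm \<Omega> p (\<lambda>x. u x - \<phi> x) < inverse (real (Suc n))" for n
    using u by (auto simp: Sobolev_space_0_def)
  then obtain \<phi> where \<phi>: "\<And>n. test_function \<Omega> (\<phi> n)"
    and \<phi>_lim: "\<And>n. Sobolev_norm \<Omega> p (\<lambda>x. u x - \<phi> n x) < inverse (real (Suc n))"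
    by metis
  have \<phi>L: "\<phi> n \<in> Lp_space \<Omega> p" "gradient (\<phi> n) \<in> Lp_space \<Omega> p" for n
    using test_functionD[OF \<phi>[of n]] test_function_gradient[OF \<phi>[of n]] p
    by (auto intro!: continuous_bounded_support_in_Lp_space \<Omega>)
  define t where "t n = inverse (real (Suc n)) powr p" for n
  have t1: "t n \<le> 1" for n
    using p unfolding t_def by (intro powr_le1) (auto simp: field_simps)
  have t0: "t \<longlonglongrightarrow> 0"
    using p unfolding t_def by (intro tendsto_zero_powrI[OF LIMSEQ_inverse_real_of_nat tendsto_const]) auto
  have sum_le: "(\<integral>x. norm (u x - \<phi> n x) powr p \<partial>lebesgue_on \<Omega>) + (\<integral>x. norm (g x - gradient (\<phi> n) x) powr p \<partial>lebesgue_on \<Omega>) \<le> t n" for n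
    unfolding Sobolev_norm_diff_test_function[OF \<Omega> p(1) uL g \<phi>, symmetric] t_def
    using \<phi>_lim[of n] p by (intro powr_mono2) (auto simp: Sobolev_norm_def)
  have u_le: "(\<integral>x. norm (u x - \<phi> n x) powr p \<partial>lebesgue_on \<Omega>) \<le> t n" 
    and g_le: "(\<integral>x. norm (g x - gradient (\<phi> n) x) powr p \<partial>lebesgue_on \<Omega>) \<le> 1" for n
  proof -
    have "0 \<le> (\<integral>x. norm (u x - \<phi> n x) powr p \<partial>lebesgue_on \<Omega>)"
      "0 \<le> (\<integral>x. norm (g x - gradient (\<phi> n) x) powr p \<partial>lebesgue_on \<Omega>)"
      by (intro Bochner_Integration.integral_nonneg; simp)+
    then show "(\<integral>x. norm (u x - \<phi> n x) powr p \<partial>lebesgue_on \<Omega>) \<le> t n"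
      "(\<integral>x. norm (g x - gradient (\<phi> n) x) powr p \<partial>lebesgue_on \<Omega>) \<le> 1"
      using sum_le[of n] t1[of n] by linarith+
  qed
  define I where "I = 2 powr p * ((\<integral>x. norm (g x) powr p \<partial>lebesgue_on \<Omega>) + 1)"
  have "0 \<le> I" unfolding I_def by simp
  define K where "K = ennreal ((p * (real DIM('a) - 1) / (real DIM('a) - p)) powr ps) * epow (ennreal I) (ps / p)"
  have grad: "(\<integral>\<^sup>+x. ennreal (norm (gradient (\<phi> n) x) powr p) \<partial>lborel) \<le> ennreal I" for n
  proof -
    have int: "integrable (lebesgue_on \<Omega>) (\<lambda>x. norm (gradient (\<phi> n) x) powr p)"
      "integrable (lebesgue_on \<Omega>) (\<lambda>x. norm (g x) powr p)"
      "integrable (lebesgue_on \<Omega>) (\<lambda>x. norm (g x - gradient (\<phi> n) x) powr p)"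
      using \<phi>L(2)[of n] g(1) Lp_space_diff[OF g(1) \<phi>L(2)[of n]] p by (auto simp: Lp_space_def)
    have "gradient (\<phi> n) x = 0" if "x \<notin> \<Omega>" for x
      using test_function_gradient(2)[OF \<phi>[of n]] \<phi>[of n] that by (auto simp: test_function_def)
    then have "(\<integral>\<^sup>+x. ennreal (norm (gradient (\<phi> n) x) powr p) \<partial>lborel)
       = (\<integral>\<^sup>+x. ennreal (norm (gradient (\<phi> n) x) powr p) \<partial>lebesgue_on \<Omega>)"
      by (intro nn_integral_lebesgue_on_supported[symmetric] \<Omega>) auto
    also have "\<dots> = ennreal (\<integral>x. norm (gradient (\<phi> n) x) powr p \<partial>lebesgue_on \<Omega>)"
      by (intro nn_integral_eq_integral int) auto
    also have "(\<integral>x. norm (gradient (\<phi> n) x) powr p \<partial>lebesgue_on \<Omega>)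
      \<le> (\<integral>x. 2 powr p * (norm (g x) powr p + norm (g x - gradient (\<phi> n) x) powr p) \<partial>lebesgue_on \<Omega>)"
    proof (rule integral_mono)
      show "norm (gradient (\<phi> n) x) powr p \<le> 2 powr p * (norm (g x) powr p + norm (g x - gradient (\<phi> n) x) powr p)" for x
        using norm_diff_powr_le[of p "g x" "g x - gradient (\<phi> n) x"] p by simp
    qed (use int in simp_all)
    also have "\<dots> \<le> I"
      unfolding I_def using int g_le[of n] by (simp add: Bochner_Integration.integral_add)
    finally show ?thesis by (simp add: ennreal_leI)
  qed
  have bound: "(\<integral>\<^sup>+x. ennreal (norm (\<phi> n x) powr ps) \<partial>lebesgue_on \<Omega>) \<le> K" for n
  proof -
    have "\<phi> n x = 0" if "x \<notin> \<Omega>" for x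
      using \<phi>[of n] that closure_subset[of "{x. \<phi> n x \<noteq> 0}"] by (auto simp: test_function_def)
    then have "(\<integral>\<^sup>+x. ennreal (norm (\<phi> n x) powr ps) \<partial>lebesgue_on \<Omega>) = (\<integral>\<^sup>+x. ennreal (\<bar>\<phi> n x\<bar> powr ps) \<partial>lborel)"
      by (subst nn_integral_lebesgue_on_supported) (auto intro: \<Omega>)
    also have "\<dots> \<le> ennreal ((p * (real DIM('a) - 1) / (real DIM('a) - p)) powr ps) * epow (\<integral>\<^sup>+x. ennreal (norm (gradient (\<phi> n) x) powr p) \<partial>lborel) (ps / p)"
      unfolding ps_def
      by (intro Sobolev_inequality N p test_functionD[OF \<phi>[of n]])
    also have "\<dots> \<le> K"
      unfolding K_def using ps p by (intro mult_left_mono epow_mono grad) auto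
    finally show ?thesis .
  qed
  have "\<exists>r::nat\<Rightarrow>nat. strict_mono r \<and> (AE x in lebesgue_on \<Omega>. (\<lambda>n. norm (u x - \<phi> (r n) x) powr p) \<longlonglongrightarrow> 0)"
  proof (rule tendsto_L1_AE_subseq)
    show "integrable (lebesgue_on \<Omega>) (\<lambda>x. norm (u x - \<phi> n x) powr p)" for n
      using Lp_space_diff[OF uL \<phi>L(1)[of n]] p by (auto simp: Lp_space_def)
    show "(\<lambda>n. \<integral>x. norm (norm (u x - \<phi> n x) powr p) \<partial>lebesgue_on \<Omega>) \<longlonglongrightarrow> 0"
      using u_le by (intro tendsto_sandwich[OF _ _ tendsto_const t0] always_eventually) auto
  qed
  then obtain r where r: "AE x in lebesgue_on \<Omega>. (\<lambda>n. norm (u x - \<phi> (r n) x) powr p) \<longlonglongrightarrow> 0"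
    by auto
  have "AE x in lebesgue_on \<Omega>. ennreal (norm (u x) powr ps) = liminf (\<lambda>n. ennreal (norm (\<phi> (r n) x) powr ps))"
    using r
  proof eventually_elim
    case (elim x)
    have "(\<lambda>n. (norm (u x - \<phi> (r n) x) powr p) powr (1 / p)) \<longlonglongrightarrow> 0"
      using p by (intro tendsto_zero_powrI[OF elim tendsto_const]) auto
    then have "(\<lambda>n. norm (u x - \<phi> (r n) x)) \<longlonglongrightarrow> 0"
      using p by (simp add: powr_powr)
    then have "(\<lambda>n. u x - (u x - \<phi> (r n) x)) \<longlonglongrightarrow> u x - 0"
      by (rule tendsto_diff[OF tendsto_const tendsto_norm_zero_cancel])
    then have "(\<lambda>n. \<phi> (r n) x) \<longlonglongrightarrow> u x" by simp
    then have "(\<lambda>n. ennreal (norm (\<phi> (r n) x) powr ps)) \<longlonglongrightarrow> ennreal (norm (u x) powr ps)"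
      using ps by (intro tendsto_ennrealI tendsto_powr2[OF tendsto_norm tendsto_const]) simp_all
    then show ?case by (rule lim_imp_Liminf[OF sequentially_bot, symmetric])
  qed
  then have "(\<integral>\<^sup>+x. ennreal (norm (u x) powr ps) \<partial>lebesgue_on \<Omega>)
    = (\<integral>\<^sup>+x. liminf (\<lambda>n. ennreal (norm (\<phi> (r n) x) powr ps)) \<partial>lebesgue_on \<Omega>)"
    by (rule nn_integral_cong_AE)
  also have "\<dots> \<le> liminf (\<lambda>n. \<integral>\<^sup>+x. ennreal (norm (\<phi> (r n) x) powr ps) \<partial>lebesgue_on \<Omega>)"
  proof (rule nn_integral_liminf)
    fix n
    have [measurable]: "\<phi> (r n) \<in> borel_measurable (lebesgue_on \<Omega>)"
      using \<phi>L(1)[of "r n"] by (simp add: Lp_space_def)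
    show "(\<lambda>x. ennreal (norm (\<phi> (r n) x) powr ps)) \<in> borel_measurable (lebesgue_on \<Omega>)"
      by measurable
  qed
  also have "\<dots> \<le> liminf (\<lambda>n. K)"
    by (intro Liminf_mono always_eventually allI bound)
  also have "\<dots> = K" by (simp add: Liminf_const)
  also have "K < \<infinity>"
  proof -
    have "ps / p \<noteq> 0" using ps p by simp
    then have "epow (ennreal I) (ps / p) < \<infinity>"
      using epow_ennreal[OF \<open>0 \<le> I\<close>] by simp
    then show ?thesis
      by (simp add: K_def ennreal_mult_less_top)
  qed
  finally have "integrable (lebesgue_on \<Omega>) (\<lambda>x. norm (u x) powr ps)"
    by (intro integrableI_bounded) simp_all
  then show ?thesis by (simp add: Lp_space_def)
qed

lemma powr_le_1_plus_powr:
  fixes a s q :: real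
  assumes "0 \<le> a" "0 < s" "s \<le> q"
  shows "a powr s \<le> 1 + a powr q"
proof (cases "a \<le> 1")
  case True
  then have "a powr s \<le> 1" using assms by (intro powr_le1) auto
  then show ?thesis by (simp add: add_increasing2)
next
  case False
  then have "a powr s \<le> a powr q" using assms by (intro powr_mono) auto
  then show ?thesis by simp
qed

lemma Lp_space_mono:
  fixes f :: "'a::euclidean_space \<Rightarrow> 'b::euclidean_space"
  assumes fin: "finite_measure (lebesgue_on \<Omega>)" and f: "f \<in> Lp_space \<Omega> q" and s: "0 < s" "s \<le> q"
  shows "f \<in> Lp_space \<Omega> s"
proof -
  interpret finite_measure "lebesgue_on \<Omega>" by (rule fin)
  have [measurable]: "f \<in> borel_measurable (lebesgue_on \<Omega>)" and q: "integrable (lebesgue_on \<Omega>) (\<lambda>x. norm (f x) powr q)"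
    using f by (auto simp: Lp_space_def)
  have "integrable (lebesgue_on \<Omega>) (\<lambda>x. norm (f x) powr s)"
    by (rule Bochner_Integration.integrable_bound[OF Bochner_Integration.integrable_add[OF integrable_const[of 1] q]])
      (use powr_le_1_plus_powr[OF _ s] in \<open>auto intro!: AE_I2\<close>)
  then show ?thesis by (simp add: Lp_space_def)
qed

section \<open>Lebesgue norms as functions of the exponent\<close>

lemma Lp_norm_pos:
  fixes f :: "'a::euclidean_space \<Rightarrow> real"
  assumes f: "f \<in> Lp_space \<Omega> s" and nz: "\<not> (AE x in lebesgue_on \<Omega>. f x = 0)"
  shows "0 < Lp_norm \<Omega> s f"
proof -
  have "integrable (lebesgue_on \<Omega>) (\<lambda>x. norm (f x) powr s)" using f by (simp add: Lp_space_def)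
  then have "(\<integral>x. norm (f x) powr s \<partial>lebesgue_on \<Omega>) \<noteq> 0"
    using nz by (subst integral_nonneg_eq_0_iff_AE) auto
  then show ?thesis unfolding Lp_norm_def by simp
qed

text \<open>
  Dominated convergence with the majorant \<open>1 + norm (f x) powr q\<close>. Since \<open>f\<close> is not almost everywhere
  \<open>0\<close>, the base of the outer power \<open>1 / s\<close> has a nonzero limit, as continuity of \<^const>\<open>powr\<close> requires.
\<close>

lemma Lp_norm_tendsto_at_left:
  fixes f :: "'a::euclidean_space \<Rightarrow> real"
  assumes fin: "finite_measure (lebesgue_on \<Omega>)" and f: "f \<in> Lp_space \<Omega> q" and q: "0 < q"
    and nz: "\<not> (AE x in lebesgue_on \<Omega>. f x = 0)"
  shows "((\<lambda>s. Lp_norm \<Omega> s f) \<longlongrightarrow> Lp_norm \<Omega> q f) (at_left q)"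
proof -
  interpret finite_measure "lebesgue_on \<Omega>" by (rule fin)
  have [measurable]: "f \<in> borel_measurable (lebesgue_on \<Omega>)" and qi: "integrable (lebesgue_on \<Omega>) (\<lambda>x. norm (f x) powr q)"
    using f by (auto simp: Lp_space_def)
  have "((\<lambda>s. \<integral>x. norm (f x) powr s \<partial>lebesgue_on \<Omega>) \<longlongrightarrow> (\<integral>x. norm (f x) powr q \<partial>lebesgue_on \<Omega>)) (at_left q)"
  proof (rule tendsto_at_left_sequentially[OF q])
    fix S :: "nat \<Rightarrow> real"
    assume S: "\<And>n. S n < q" "\<And>n. 0 < S n" "S \<longlonglongrightarrow> q"
    show "(\<lambda>n. \<integral>x. norm (f x) powr S n \<partial>lebesgue_on \<Omega>) \<longlonglongrightarrow> (\<integral>x. norm (f x) powr q \<partial>lebesgue_on \<Omega>)"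
    proof (rule integral_dominated_convergence)
      show "integrable (lebesgue_on \<Omega>) (\<lambda>x. 1 + norm (f x) powr q)"
        using qi by simp
      show "AE x in lebesgue_on \<Omega>. norm (norm (f x) powr S n) \<le> 1 + norm (f x) powr q" for n
        using powr_le_1_plus_powr[OF abs_ge_zero S(2) less_imp_le[OF S(1)]] by (intro AE_I2) simp
      have "(\<lambda>n. a powr S n) \<longlonglongrightarrow> a powr q" for a :: real
        using S(3) by (cases "a = 0") (auto intro: tendsto_powr)
      then show "AE x in lebesgue_on \<Omega>. (\<lambda>n. norm (f x) powr S n) \<longlonglongrightarrow> norm (f x) powr q"
        by simp
    qed measurable
  qed
  moreover have "(\<integral>x. norm (f x) powr q \<partial>lebesgue_on \<Omega>) \<noteq> 0"
    using nz qi by (subst integral_nonneg_eq_0_iff_AE) auto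
  ultimately show ?thesis unfolding Lp_norm_def
    using q by (intro tendsto_powr tendsto_intros) auto
qed

text \<open>
  Hoelder's inequality for \<open>norm (f x) powr q\<close> and the constant function \<open>1\<close>, with weights \<open>s / q\<close> and
  \<open>1 - s / q\<close>.
\<close>

lemma Lp_norm_mono:
  fixes f :: "'a::euclidean_space \<Rightarrow> 'b::euclidean_space"
  assumes fin: "finite_measure (lebesgue_on \<Omega>)" and f: "f \<in> Lp_space \<Omega> q" and s: "0 < s" "s < q"
  shows "Lp_norm \<Omega> s f \<le> measure (lebesgue_on \<Omega>) (space (lebesgue_on \<Omega>)) powr (1 / s - 1 / q) * Lp_norm \<Omega> q f"
proof -
  interpret finite_measure "lebesgue_on \<Omega>" by (rule fin)
  let ?M = "lebesgue_on \<Omega>"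
  define \<mu> where "\<mu> = measure ?M (space ?M)"
  have [measurable]: "f \<in> borel_measurable ?M" and qi: "integrable ?M (\<lambda>x. norm (f x) powr q)"
    using f by (auto simp: Lp_space_def)
  have si: "integrable ?M (\<lambda>x. norm (f x) powr s)"
    using Lp_space_mono[OF fin f s(1)] s(2) by (simp add: Lp_space_def)
  define J where "J = (\<integral>x. norm (f x) powr q \<partial>?M)"
  have "0 \<le> J" "0 \<le> \<mu>" by (simp_all add: J_def \<mu>_def)
  have "ennreal (\<integral>x. norm (f x) powr s \<partial>?M) = (\<integral>\<^sup>+x. ennreal (norm (f x) powr s) \<partial>?M)"
    using si by (intro nn_integral_eq_integral[symmetric]) auto
  also have "\<dots> = (\<integral>\<^sup>+x. epow (ennreal (norm (f x) powr q)) (s / q) * epow (ennreal 1) (1 - s / q) \<partial>?M)"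
    using s by (simp add: epow_ennreal powr_powr)
  also have "\<dots> \<le> epow (\<integral>\<^sup>+x. ennreal (norm (f x) powr q) \<partial>?M) (s / q) * epow (\<integral>\<^sup>+x. ennreal 1 \<partial>?M) (1 - s / q)"
    using s by (intro nn_integral_Holder_two) auto
  also have "(\<integral>\<^sup>+x. ennreal (norm (f x) powr q) \<partial>?M) = ennreal J"
    unfolding J_def using qi by (intro nn_integral_eq_integral) auto
  also have "(\<integral>\<^sup>+x. ennreal 1 \<partial>?M) = ennreal \<mu>"
    by (simp add: \<mu>_def emeasure_eq_measure)
  also have "epow (ennreal J) (s / q) * epow (ennreal \<mu>) (1 - s / q) = ennreal (J powr (s / q) * \<mu> powr (1 - s / q))"
    using s \<open>0 \<le> J\<close> \<open>0 \<le> \<mu>\<close> by (simp add: epow_ennreal ennreal_mult)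
  finally have "(\<integral>x. norm (f x) powr s \<partial>?M) \<le> J powr (s / q) * \<mu> powr (1 - s / q)"
    by simp
  then have "Lp_norm \<Omega> s f \<le> (J powr (s / q) * \<mu> powr (1 - s / q)) powr (1 / s)"
    unfolding Lp_norm_def using s by (intro powr_mono2) auto
  also have "\<dots> = J powr (1 / q) * \<mu> powr ((1 - s / q) * (1 / s))"
    using s by (simp add: powr_mult powr_powr)
  also have "(1 - s / q) * (1 / s) = 1 / s - 1 / q"
    using s by (simp add: field_simps)
  finally show ?thesis by (simp add: Lp_norm_def J_def \<mu>_def mult.commute)
qed

section \<open>Left continuity of the best Sobolev constant\<close>

theorem theorem6:
  fixes \<Omega> :: "'a::euclidean_space set" and p q :: real
  assumes "DIM('a) \<ge> 2"
    and "1 < p" and "p < real DIM('a)"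
    and "bounded_smooth_domain \<Omega>"
    and "1 < q" and "q \<le> critical_exponent (real DIM('a)) p"
  shows "((\<lambda>s. Sobolev_quotient_inf \<Omega> p s) \<longlongrightarrow> Sobolev_quotient_inf \<Omega> p q) (at_left q)"
proof -
  \<comment> \<open>Writing the infimum over functions rather than over values makes the index set V
      independent of s.\<close>
  define V where "V = {u \<in> Sobolev_space_0 \<Omega> p. \<not> (AE x in lebesgue_on \<Omega>. u x = 0)}"
  define A where "A u = Lp_norm \<Omega> p (weak_gradient \<Omega> u) powr p" for u
  define R where "R s u = A u / Lp_norm \<Omega> s u powr p" for s u
  have quot_eq: "Sobolev_quotient_inf \<Omega> p s = (INF u\<in>V. R s u)" for s
    unfolding Sobolev_quotient_inf_def by (rule arg_cong[where f=Inf]) (auto simp: V_def R_def A_def)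
  have R_nonneg: "0 \<le> R s u" for s u by (simp add: R_def A_def)
  then have bdd: "bdd_below (R s ` V)" for s by (intro bdd_belowI2)
  have \<Omega>: "open \<Omega>" "\<Omega> \<noteq> {}" "bounded \<Omega>"
    using assms(4) by (auto simp: bounded_smooth_domain_def)
  then have \<Omega>_meas: "\<Omega> \<in> lmeasurable" by (simp add: bounded_set_imp_lmeasurable borel_open)
  then have fin: "finite_measure (lebesgue_on \<Omega>)"
    by (rule finite_measure_lebesgue_on)
  define \<mu> where "\<mu> = measure (lebesgue_on \<Omega>) (space (lebesgue_on \<Omega>))"
  have "\<mu> = measure lebesgue \<Omega>"
    unfolding \<mu>_def using \<Omega>_meas by (simp add: measure_restrict_space fmeasurableD)
  moreover have "measure lebesgue \<Omega> \<noteq> 0"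
    using open_not_negligible[OF \<Omega>(1,2)] \<Omega>_meas by (simp add: negligible_iff_measure)
  ultimately have \<mu>: "0 < \<mu>" by (simp add: zero_less_measure_iff)
  have Lq: "u \<in> Lp_space \<Omega> q" if "u \<in> V" for u
    using Lp_space_mono[OF fin Sobolev_embedding[OF assms(1-3) \<Omega>(1)]] that assms(5,6) by (auto simp: V_def)
  have nz: "\<not> (AE x in lebesgue_on \<Omega>. u x = 0)" if "u \<in> V" for u
    using that by (simp add: V_def)
  show ?thesis
  \<comment> \<open>The infimum over the empty set is an unspecified number, but the same one for all s.\<close>
  proof (cases "V = {}")
    case True
    then show ?thesis by (simp add: quot_eq)
  next
    case False
    \<comment> \<open>The constant that the comparison of norms produces; it tends to 1 as s tends to q.\<close>
    define c where "c s = \<mu> powr (- (p * (1 / s - 1 / q)))" for s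
    have c_le: "c s * (INF u\<in>V. R q u) \<le> (INF u\<in>V. R s u)" if s: "0 < s" "s < q" for s
    proof (rule cINF_greatest[OF False])
      fix u assume u: "u \<in> V"
      have pos: "0 < Lp_norm \<Omega> s u" "0 < Lp_norm \<Omega> q u"
        using Lp_norm_pos[OF _ nz[OF u]] Lp_space_mono[OF fin Lq[OF u] s(1)] Lq[OF u] s(2) by auto
      have "Lp_norm \<Omega> s u powr p \<le> (\<mu> powr (1 / s - 1 / q) * Lp_norm \<Omega> q u) powr p"
        using Lp_norm_mono[OF fin Lq[OF u] s] pos assms(2) by (intro powr_mono2) (auto simp: \<mu>_def)
      also have "\<dots> = \<mu> powr (p * (1 / s - 1 / q)) * Lp_norm \<Omega> q u powr p"
        by (simp add: powr_mult powr_powr mult.commute)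
      finally have "A u / (\<mu> powr (p * (1 / s - 1 / q)) * Lp_norm \<Omega> q u powr p) \<le> R s u"
        unfolding R_def using pos \<mu> by (intro divide_left_mono) (auto simp: A_def)
      then have "c s * R q u \<le> R s u"
        unfolding R_def c_def by (simp add: powr_minus divide_inverse mult_ac)
      moreover have "c s * (INF u\<in>V. R q u) \<le> c s * R q u"
        by (intro mult_left_mono cINF_lower bdd u) (simp add: c_def)
      ultimately show "c s * (INF u\<in>V. R q u) \<le> R s u" by simp
    qed
    have near: "\<forall>\<^sub>F s in at_left q. 0 < s \<and> s < q"
      using assms(5) eventually_at_left_real[of 0 q] by auto
    show ?thesis unfolding quot_eq
    proof (rule order_tendstoI)
      fix a assume a: "a < (INF u\<in>V. R q u)"
      have "(c \<longlongrightarrow> \<mu> powr (- (p * (1 / q - 1 / q)))) (at_left q)"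
        unfolding c_def using \<mu> assms(5) by (intro tendsto_intros) auto
      then have "((\<lambda>s. c s * (INF u\<in>V. R q u)) \<longlongrightarrow> 1 * (INF u\<in>V. R q u)) (at_left q)"
        using \<mu> by (intro tendsto_mult tendsto_const) simp
      then have "\<forall>\<^sub>F s in at_left q. a < c s * (INF u\<in>V. R q u)"
        using a by (intro order_tendstoD(1)) auto
      then show "\<forall>\<^sub>F s in at_left q. a < (INF u\<in>V. R s u)"
        using near by eventually_elim (use c_le in force)
    next
      fix a assume "(INF u\<in>V. R q u) < a"
      then obtain u where u: "u \<in> V" "R q u < a"
        using cINF_less_iff[OF False bdd] by auto
      have "Lp_norm \<Omega> q u \<noteq> 0"
        using Lp_norm_pos[OF Lq nz, OF u(1) u(1)] by simp
      then have "((\<lambda>s. R s u) \<longlongrightarrow> R q u) (at_left q)"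
        unfolding R_def using Lp_norm_tendsto_at_left[OF fin Lq _ nz, OF u(1) _ u(1)] assms(5)
        by (intro tendsto_intros) auto
      then have "\<forall>\<^sub>F s in at_left q. R s u < a"
        using u(2) by (intro order_tendstoD(2)) auto
      then show "\<forall>\<^sub>F s in at_left q. (INF u\<in>V. R s u) < a"
        by eventually_elim (rule le_less_trans[OF cINF_lower[OF bdd u(1)]])
    qed
  qed
qed

end
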